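(* Let $q\ge2$ be an integer. For every integer $s\ge 2$ there exist constants $\kappa_s>0$ and $C>0$ (depending only on $q$ and $s$) such that for every $q$-multiplicative sequence $f\colon\mathbb{N}_0\to\mathbb{U}$ and every integer $N\ge1$, $$\|f\|_{U^s[N]}\le C\,\|f\|_{U^2[N]}^{\kappa_s}.$$
   Context: $\mathbb{N}_0=\{0,1,2,\dots\}$, $\mathbb{U}=\{z\in\mathbb{C}:|z|=1\}$. A sequence $f\colon\mathbb{N}_0\to\mathbb{U}$ is $q$-multiplicative if for all integers $t,m,n\ge 0$ with $m<q^t$ and $q^t\mid n$ one has $f(m+n)=f(m)f(n)$. For $N\ge1$ let $[N]=\{0,1,\dots,N-1\}$. For $s\ge1$ let $\Pi(N)$ be the set of $\vec n=(n_0,\dots,n_s)\in\mathbb{Z}^{s+1}$ such that $n_0+\omega_1n_1+\dots+\omega_sn_s\in[N]$ for all $\omega\in\{0,1\}^s$. The Gowers uniformity norm $\|f\|_{U^s[N]}\ge0$ is defined by $$\|f\|_{U^s[N]}^{2^s}=\frac{1}{|\Pi(N)|}\sum_{\vec n\in\Pi(N)}\prod_{\omega\in\{0,1\}^s}\mathcal{C}^{|\omega|}f(n_0+\omega_1n_1+\dots+\omega_sn_s),$$ where $\mathcal{C}$ denotes complex conjugation and $|\omega|=\omega_1+\dots+\omega_s$. *)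

theory Defs
  imports "HOL-Analysis.Analysis"
begin

definition q_multiplicative :: "nat \<Rightarrow> (nat \<Rightarrow> complex) \<Rightarrow> bool" where
  "q_multiplicative q f \<longleftrightarrow>
     (\<forall>n. cmod (f n) = 1) \<and>
     (\<forall>t m n. m < q ^ t \<longrightarrow> q ^ t dvd n \<longrightarrow> f (m + n) = f m * f n)"

text \<open>Cube point n_0 + sum of n_i over i in S, where S \<subseteq> {1..s} encodes omega
  and the vector (n_0,...,n_s) is a list of length s+1.\<close>
definition cube_pt :: "int list \<Rightarrow> nat set \<Rightarrow> int" where
  "cube_pt v S = v ! 0 + (\<Sum>i\<in>S. v ! i)"

definition Pi_set :: "nat \<Rightarrow> nat \<Rightarrow> int list set" where
  "Pi_set s N = {v. length v = s + 1 \<and>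
      (\<forall>S. S \<subseteq> {1..s} \<longrightarrow> 0 \<le> cube_pt v S \<and> cube_pt v S < int N)}"

text \<open>The normalized sum defining the 2^s-th power of the Gowers norm
  (f extended by 0 to negative integers is never evaluated there).\<close>
definition gowers_avg :: "nat \<Rightarrow> nat \<Rightarrow> (nat \<Rightarrow> complex) \<Rightarrow> complex" where
  "gowers_avg s N f =
     (\<Sum>v\<in>Pi_set s N. \<Prod>S\<in>Pow {1..s}.
        (if odd (card S) then cnj else id) (f (nat (cube_pt v S))))
     / of_nat (card (Pi_set s N))"

text \<open>The average is a nonnegative real; the norm is its 2^s-th root.\<close>
definition gowers_norm :: "nat \<Rightarrow> nat \<Rightarrow> (nat \<Rightarrow> complex) \<Rightarrow> real" where
  "gowers_norm s N f = root (2 ^ s) (Re (gowers_avg s N f))"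

end

theory Submission
  imports Defs
begin

text \<open>
  Let d_i be the sum over j < q of |f(q^i (j + 1)) - f(q^i j) f(q^i)|; it measures how far f is from
  a linear phase near the digit position i. Both norms are controlled by S = sum of d_i^2 over the
  digit positions of N: the U^s average is at most C exp(-c S), and the U^2 average is at least
  c' exp(-K S).

  Upper bound. Splitting off the lowest k digits of all coordinates of a cube expresses the cube sum
  as a sum of cube sums of n \<mapsto> f(q^k n) with unimodular weights, where each vertex carries a shift r
  (the carry, between 0 and s) and an upper bound M equal to N or N + 1 with N the current truncation.
  Two low parts leading to the same shifts and bounds can be chosen so that their weights differ by the
  defect at the position b = s^2 + s, so that one of the trivial q^{k(s+1)} bounds improves by a
  factor 1 - c d_b^2.

  Lower bound. A frequency w is constructed from the top digit downwards as a q-th root of the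
  previous one, staying close to f(q^i). The distance of w to f(q^i) contracts by a constant factor
  up to d_i, so the product of the digit sums loses only exp(-K S). A correlation of f with w on a
  window of length q^T bounds the U^2 norm from below by Cauchy-Schwarz.
\<close>

section \<open>Cube sums and digits\<close>

text \<open>Both exponents have to be quadratic in the defects: merging two unimodular weights at
  distance d saves only a multiple of d^2, so a lower bound that lost a multiple of d at some digit
  could not be compared with it. This is why the frequency is tracked through squared distances and
  through real parts near 1. On the cube side the obstacle is the carry, which differs from vertex
  to vertex. Taking the supremum over all shifts and bounds that can arise makes the recursion
  close, at the price that a cancelling pair must exist for every such choice; the size of b and the
  b + 3 digits of a block give the room for it. A block reads one defect only, so b + 3 interleaved
  chains of blocks are multiplied in order to see all positions. The sums of squares in the two
  bounds then differ by a shift of b positions, hence by a bounded amount, and kappa_s comes from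
  the quotient of the two rates.\<close>

lemma prod_Pow_insert:
  assumes "finite A" "x \<notin> A"
  shows "(\<Prod>S\<in>Pow (insert x A). h S) = (\<Prod>S\<in>Pow A. h S * h (insert x S))"
proof -
  have inj: "inj_on (insert x) (Pow A)"
    using assms(2) by (auto simp: inj_on_def)
  have "(\<Prod>S\<in>Pow (insert x A). h S) = (\<Prod>S\<in>Pow A. h S) * (\<Prod>S\<in>insert x ` Pow A. h S)"
    unfolding Pow_insert using assms by (intro prod.union_disjoint) auto
  also have "(\<Prod>S\<in>insert x ` Pow A. h S) = (\<Prod>S\<in>Pow A. h (insert x S))"
    by (simp add: prod.reindex[OF inj])
  finally show ?thesis by (simp add: prod.distrib)
qed

definition conj_parity :: "nat set \<Rightarrow> complex \<Rightarrow> complex" where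
  "conj_parity S = (if odd (card S) then cnj else id)"

lemma conj_parity_mult [simp]: "conj_parity S (x * y) = conj_parity S x * conj_parity S y"
  by (simp add: conj_parity_def)

lemma conj_parity_one [simp]: "conj_parity S 1 = 1"
  by (simp add: conj_parity_def)

lemma cmod_conj_parity [simp]: "cmod (conj_parity S x) = cmod x"
  by (simp add: conj_parity_def)

definition shifted_cubes :: "nat \<Rightarrow> (nat set \<Rightarrow> int) \<Rightarrow> (nat set \<Rightarrow> int) \<Rightarrow> int list set" where
  "shifted_cubes s r M = {v. length v = s + 1 \<and>
     (\<forall>S. S \<subseteq> {1..s} \<longrightarrow> 0 \<le> cube_pt v S + r S \<and> cube_pt v S + r S < M S)}"

definition cube_weight :: "nat \<Rightarrow> (nat \<Rightarrow> complex) \<Rightarrow> (nat set \<Rightarrow> int) \<Rightarrow> complex" where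
  "cube_weight s f x = (\<Prod>S\<in>Pow {1..s}. conj_parity S (f (nat (x S))))"

definition cube_sum :: "nat \<Rightarrow> (nat \<Rightarrow> complex) \<Rightarrow> (nat set \<Rightarrow> int) \<Rightarrow> (nat set \<Rightarrow> int) \<Rightarrow> complex" where
  "cube_sum s f r M = (\<Sum>v\<in>shifted_cubes s r M. cube_weight s f (\<lambda>S. cube_pt v S + r S))"

definition digit_vectors :: "nat \<Rightarrow> nat \<Rightarrow> int list set" where
  "digit_vectors s Q = {e. set e \<subseteq> {0..<int Q} \<and> length e = s + 1}"

lemma finite_digit_vectors [simp]: "finite (digit_vectors s Q)"
  unfolding digit_vectors_def by (rule finite_lists_length_eq) simp

lemma card_digit_vectors [simp]: "card (digit_vectors s Q) = Q ^ (s + 1)"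
  unfolding digit_vectors_def by (subst card_lists_length_eq) simp_all

lemma Pi_set_eq_shifted_cubes: "Pi_set s N = shifted_cubes s (\<lambda>_. 0) (\<lambda>_. int N)"
  by (simp add: Pi_set_def shifted_cubes_def)

lemma gowers_avg_eq_cube_sum:
  "gowers_avg s N f = cube_sum s f (\<lambda>_. 0) (\<lambda>_. int N) / of_nat (card (Pi_set s N))"
  by (simp add: gowers_avg_def cube_sum_def cube_weight_def conj_parity_def Pi_set_eq_shifted_cubes)

lemma cmod_cube_weight:
  assumes "\<And>n. cmod (f n) = 1"
  shows "cmod (cube_weight s f x) = 1"
  unfolding cube_weight_def prod_norm[symmetric] using assms by simp

lemma cube_pt_map2:
  assumes "length v = s + 1" "length e = s + 1" "S \<subseteq> {1..s}"
  shows "cube_pt (map2 (\<lambda>x y. c * x + y) v e) S = c * cube_pt v S + cube_pt e S"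
proof -
  have "(\<Sum>i\<in>S. map2 (\<lambda>x y. c * x + y) v e ! i) = (\<Sum>i\<in>S. c * v ! i + e ! i)"
    using assms by (intro sum.cong) (auto simp: subset_iff)
  then show ?thesis
    using assms by (simp add: cube_pt_def sum.distrib sum_distrib_left distrib_left)
qed

text \<open>The base point is the cube point of \<open>{}\<close>, and edge i is the difference of
  the cube points of \<open>{i}\<close> and \<open>{}\<close>, so bounds on the vertices bound every
  coordinate.\<close>

lemma shifted_cubes_subset:
  assumes "\<And>S. S \<subseteq> {1..s} \<Longrightarrow> 0 \<le> r S \<and> r S \<le> int s \<and> M S \<le> int N + 1"
  shows "shifted_cubes s r M \<subseteq> {v. set v \<subseteq> {- int (N + s) .. int (N + s)} \<and> length v = s + 1}"
proof clarify
  fix v assume v: "v \<in> shifted_cubes s r M"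
  then have len: "length v = s + 1" by (simp add: shifted_cubes_def)
  have b: "- int s \<le> cube_pt v S" "cube_pt v S \<le> int N" if "S \<subseteq> {1..s}" for S
  proof -
    have "0 \<le> cube_pt v S + r S" "cube_pt v S + r S < M S"
      using v that by (simp_all add: shifted_cubes_def)
    then show "- int s \<le> cube_pt v S" "cube_pt v S \<le> int N"
      using assms[OF that] by linarith+
  qed
  have "v ! i \<in> {- int (N + s) .. int (N + s)}" if "i < s + 1" for i
  proof (cases "i = 0")
    case True
    then show ?thesis using b[of "{}"] by (auto simp: cube_pt_def)
  next
    case False
    then have "{i} \<subseteq> {1..s}" using that by auto
    then show ?thesis using b[of "{}"] b[of "{i}"] by (auto simp: cube_pt_def)
  qed
  then show "set v \<subseteq> {- int (N + s) .. int (N + s)} \<and> length v = s + 1"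
    using len by (auto simp: in_set_conv_nth simp del: atLeastAtMost_iff)
qed

lemma
  assumes "\<And>S. S \<subseteq> {1..s} \<Longrightarrow> 0 \<le> r S \<and> r S \<le> int s \<and> M S \<le> int N + 1"
  shows finite_shifted_cubes: "finite (shifted_cubes s r M)"
    and card_shifted_cubes_le: "card (shifted_cubes s r M) \<le> (2 * (N + s) + 1) ^ (s + 1)"
proof -
  let ?B = "{v. set v \<subseteq> {- int (N + s) .. int (N + s)} \<and> length v = s + 1}"
  have fin: "finite ?B" by (rule finite_lists_length_eq) simp
  have sub: "shifted_cubes s r M \<subseteq> ?B" by (rule shifted_cubes_subset) (rule assms)
  show "finite (shifted_cubes s r M)" using sub fin by (rule finite_subset)
  have "card ?B = card {- int (N + s) .. int (N + s)} ^ (s + 1)"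
    by (rule card_lists_length_eq) simp
  also have "card {- int (N + s) .. int (N + s)} = 2 * (N + s) + 1"
    by (simp add: nat_eq_iff)
  finally show "card (shifted_cubes s r M) \<le> (2 * (N + s) + 1) ^ (s + 1)"
    using card_mono[OF fin sub] by simp
qed

lemma cmod_cube_sum_le:
  assumes "\<And>S. S \<subseteq> {1..s} \<Longrightarrow> 0 \<le> r S \<and> r S \<le> int s \<and> M S \<le> int N + 1"
    and "\<And>n. cmod (f n) = 1"
  shows "cmod (cube_sum s f r M) \<le> real ((2 * (N + s) + 1) ^ (s + 1))"
proof -
  have "cmod (cube_sum s f r M) \<le> (\<Sum>v\<in>shifted_cubes s r M. 1)"
    unfolding cube_sum_def by (rule order_trans[OF norm_sum]) (simp add: cmod_cube_weight assms(2))
  also have "\<dots> \<le> real ((2 * (N + s) + 1) ^ (s + 1))"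
    unfolding sum_constant mult_1_right of_nat_le_iff by (rule card_shifted_cubes_le) (rule assms(1))
  finally show ?thesis .
qed

section \<open>Splitting off the low digits of a cube\<close>

lemma int_div_less_iff:
  fixes a b c :: int
  assumes "c > 0"
  shows "a div c < b \<longleftrightarrow> a < b * c"
proof
  assume "a div c < b"
  then have "a div c + 1 \<le> b" by simp
  then have "(a div c + 1) * c \<le> b * c" using assms by (intro mult_right_mono) auto
  moreover have "a = a div c * c + a mod c" "a mod c < c" using assms by simp_all
  ultimately show "a < b * c" unfolding distrib_right by linarith
next
  assume "a < b * c"
  show "a div c < b"
  proof (rule ccontr)
    assume "\<not> a div c < b"
    then have "b * c \<le> a div c * c" using assms by (intro mult_right_mono) auto
    moreover have "a = a div c * c + a mod c" "0 \<le> a mod c" using assms by simp_all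
    ultimately show False using \<open>a < b * c\<close> by linarith
  qed
qed

text \<open>With d = \<open>y mod Q\<close>, the new upper bound is the ceiling of (M - d) / Q,
  written as a negated floor because \<open>div\<close> rounds down. The lower bound stays 0 since
  adding d with 0 <= d < Q to a multiple of Q does not change its sign.\<close>

lemma bounds_digit_iff:
  fixes Q x y M :: int
  assumes "Q > 0"
  shows "0 \<le> Q * x + y \<and> Q * x + y < M \<longleftrightarrow>
    0 \<le> x + y div Q \<and> x + y div Q < - ((y mod Q - M) div Q)"
proof -
  have y: "y = Q * (y div Q) + y mod Q" "0 \<le> y mod Q" "y mod Q < Q" using assms by auto
  have "Q * x + y = Q * (x + y div Q) + y mod Q" using y(1) by (simp add: algebra_simps)
  then have "0 \<le> Q * x + y \<longleftrightarrow> 0 \<le> x + y div Q"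
    using y(2,3) assms by (smt (verit) mult_less_cancel_left1 mult_nonneg_nonneg zero_le_mult_iff mult_le_cancel_left1 int_one_le_iff_zero_less mult_minus_right)
  moreover have "Q * x + y < M \<longleftrightarrow> x + y div Q < - ((y mod Q - M) div Q)"
  proof -
    have "Q * x + y < M \<longleftrightarrow> (y mod Q - M) < (- (x + y div Q)) * Q"
      unfolding \<open>Q * x + y = _\<close> by (auto simp: algebra_simps)
    also have "\<dots> \<longleftrightarrow> (y mod Q - M) div Q < - (x + y div Q)"
      by (rule int_div_less_iff[OF assms, symmetric])
    finally show ?thesis by linarith
  qed
  ultimately show ?thesis by blast
qed

lemma map2_mem_shifted_cubes_iff:
  assumes "length e = s + 1" "length v = s + 1" "Q > 0"
  shows "map2 (\<lambda>x y. int Q * x + y) v e \<in> shifted_cubes s r M \<longleftrightarrow>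
    v \<in> shifted_cubes s (\<lambda>S. (cube_pt e S + r S) div int Q)
      (\<lambda>S. - (((cube_pt e S + r S) mod int Q - M S) div int Q))"
proof -
  have "0 \<le> cube_pt (map2 (\<lambda>x y. int Q * x + y) v e) S + r S \<and>
      cube_pt (map2 (\<lambda>x y. int Q * x + y) v e) S + r S < M S \<longleftrightarrow>
      0 \<le> cube_pt v S + (cube_pt e S + r S) div int Q \<and>
      cube_pt v S + (cube_pt e S + r S) div int Q < - (((cube_pt e S + r S) mod int Q - M S) div int Q)"
    if "S \<subseteq> {1..s}" for S
    using bounds_digit_iff[of "int Q" "cube_pt v S" "cube_pt e S + r S" "M S"] assms
    by (simp add: cube_pt_map2[OF assms(2,1) that] add.assoc)
  then show ?thesis
    using assms by (simp add: shifted_cubes_def)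
qed

lemma bij_betw_digit_fibre:
  assumes e: "e \<in> digit_vectors s Q" and Q: "Q > 0"
  shows "bij_betw (\<lambda>v. map2 (\<lambda>x y. int Q * x + y) v e)
    (shifted_cubes s (\<lambda>S. (cube_pt e S + r S) div int Q)
      (\<lambda>S. - (((cube_pt e S + r S) mod int Q - M S) div int Q)))
    {v \<in> shifted_cubes s r M. map (\<lambda>x. x mod int Q) v = e}"
proof -
  have le: "length e = s + 1" and e_sub: "set e \<subseteq> {0..<int Q}"
    using e by (simp_all add: digit_vectors_def)
  have e_rng: "0 \<le> e ! i \<and> e ! i < int Q" if "i < s + 1" for i
    using subsetD[OF e_sub nth_mem[of i e]] that le by simp
  define J where "J v = map2 (\<lambda>x y. int Q * x + y) v e" for v :: "int list"
  define W where "W = shifted_cubes s (\<lambda>S. (cube_pt e S + r S) div int Q)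
      (\<lambda>S. - (((cube_pt e S + r S) mod int Q - M S) div int Q))"
  have W_len: "length v = s + 1" if "v \<in> W" for v
    using that by (simp add: W_def shifted_cubes_def)
  have C_len: "length v = s + 1" if "v \<in> shifted_cubes s r M" for v
    using that by (simp add: shifted_cubes_def)
  have iff: "J v \<in> shifted_cubes s r M \<longleftrightarrow> v \<in> W" if "length v = s + 1" for v
    unfolding J_def W_def by (rule map2_mem_shifted_cubes_iff[OF le that Q])
  have mod_J: "map (\<lambda>x. x mod int Q) (J v) = e" if "length v = s + 1" for v
    by (rule nth_equalityI) (use that le e_rng in \<open>simp_all add: J_def\<close>)
  have div_J: "map (\<lambda>x. x div int Q) (J v) = v" if "length v = s + 1" for v
    by (rule nth_equalityI) (use that le e_rng Q in \<open>simp_all add: J_def\<close>)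
  have J_div: "J (map (\<lambda>x. x div int Q) v) = v"
    if "length v = s + 1" and "map (\<lambda>x. x mod int Q) v = e" for v
    by (rule nth_equalityI) (use that in \<open>auto simp: J_def\<close>)
  have "bij_betw J W {v \<in> shifted_cubes s r M. map (\<lambda>x. x mod int Q) v = e}"
  proof (rule bij_betwI[where g = "map (\<lambda>x. x div int Q)"])
    show "J \<in> W \<rightarrow> {v \<in> shifted_cubes s r M. map (\<lambda>x. x mod int Q) v = e}"
      using iff mod_J W_len by blast
    show "map (\<lambda>x. x div int Q) \<in> {v \<in> shifted_cubes s r M. map (\<lambda>x. x mod int Q) v = e} \<rightarrow> W"
    proof (rule Pi_I)
      fix v assume "v \<in> {v \<in> shifted_cubes s r M. map (\<lambda>x. x mod int Q) v = e}"
      then have v: "v \<in> shifted_cubes s r M" and "map (\<lambda>x. x mod int Q) v = e" by simp_all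
      then have "J (map (\<lambda>x. x div int Q) v) = v" by (intro J_div C_len)
      then show "map (\<lambda>x. x div int Q) v \<in> W"
        using iff[of "map (\<lambda>x. x div int Q) v"] v C_len[OF v] by simp
    qed
    show "J (map (\<lambda>x. x div int Q) v) = v"
      if "v \<in> {v \<in> shifted_cubes s r M. map (\<lambda>x. x mod int Q) v = e}" for v
      using that by (intro J_div C_len) simp_all
    show "map (\<lambda>x. x div int Q) (J v) = v" if "v \<in> W" for v
      using that by (intro div_J W_len)
  qed
  then show ?thesis unfolding J_def W_def .
qed

text \<open>Divide every coordinate by Q and group by the remainders e. At vertex S the remainders
  add up to \<open>cube_pt e S + r S\<close>, which may exceed Q: its quotient becomes the new
  carry, and its remainder is the digit part that multiplicativity separates from the multiple of
  Q.\<close>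

lemma cube_sum_split_digits:
  assumes Q: "Q > 0"
    and mult: "\<And>d n. d < Q \<Longrightarrow> f (d + Q * n) = f d * f (Q * n)"
    and fin: "finite (shifted_cubes s r M)"
  shows "cube_sum s f r M = (\<Sum>e\<in>digit_vectors s Q.
      cube_weight s f (\<lambda>S. (cube_pt e S + r S) mod int Q) *
      cube_sum s (\<lambda>n. f (Q * n)) (\<lambda>S. (cube_pt e S + r S) div int Q)
        (\<lambda>S. - (((cube_pt e S + r S) mod int Q - M S) div int Q)))"
proof -
  have "(\<lambda>v. map (\<lambda>x. x mod int Q) v) ` shifted_cubes s r M \<subseteq> digit_vectors s Q"
    using Q by (auto simp: shifted_cubes_def digit_vectors_def)
  then have "cube_sum s f r M = (\<Sum>e\<in>digit_vectors s Q.
      \<Sum>v\<in>{v \<in> shifted_cubes s r M. map (\<lambda>x. x mod int Q) v = e}.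
        cube_weight s f (\<lambda>S. cube_pt v S + r S))"
    unfolding cube_sum_def by (intro sum.group[symmetric] fin) simp_all
  also have "\<dots> = (\<Sum>e\<in>digit_vectors s Q.
      cube_weight s f (\<lambda>S. (cube_pt e S + r S) mod int Q) *
      cube_sum s (\<lambda>n. f (Q * n)) (\<lambda>S. (cube_pt e S + r S) div int Q)
        (\<lambda>S. - (((cube_pt e S + r S) mod int Q - M S) div int Q)))"
  proof (rule sum.cong[OF refl])
    fix e assume e: "e \<in> digit_vectors s Q"
    let ?V = "shifted_cubes s (\<lambda>S. (cube_pt e S + r S) div int Q)
        (\<lambda>S. - (((cube_pt e S + r S) mod int Q - M S) div int Q))"
    have "(\<Sum>v\<in>{v \<in> shifted_cubes s r M. map (\<lambda>x. x mod int Q) v = e}.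
        cube_weight s f (\<lambda>S. cube_pt v S + r S)) =
      (\<Sum>v\<in>?V. cube_weight s f (\<lambda>S. cube_pt (map2 (\<lambda>x y. int Q * x + y) v e) S + r S))"
      by (rule sum.reindex_bij_betw[OF bij_betw_digit_fibre[OF e Q], symmetric])
    also have "\<dots> = (\<Sum>v\<in>?V. cube_weight s f (\<lambda>S. (cube_pt e S + r S) mod int Q) *
        cube_weight s (\<lambda>n. f (Q * n)) (\<lambda>S. cube_pt v S + (cube_pt e S + r S) div int Q))"
    proof (rule sum.cong[OF refl])
      fix v assume v: "v \<in> ?V"
      have "conj_parity S (f (nat (cube_pt (map2 (\<lambda>x y. int Q * x + y) v e) S + r S))) =
        conj_parity S (f (nat ((cube_pt e S + r S) mod int Q))) *
        conj_parity S (f (Q * nat (cube_pt v S + (cube_pt e S + r S) div int Q)))"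
        if S: "S \<subseteq> {1..s}" for S
      proof -
        define y where "y = cube_pt e S + r S"
        define x where "x = cube_pt v S + y div int Q"
        have "cube_pt (map2 (\<lambda>x y. int Q * x + y) v e) S = int Q * cube_pt v S + cube_pt e S"
          using v e S by (intro cube_pt_map2[of _ s]) (auto simp: shifted_cubes_def digit_vectors_def)
        then have "cube_pt (map2 (\<lambda>x y. int Q * x + y) v e) S + r S
            = int Q * cube_pt v S + y"
          by (simp add: y_def)
        also have "\<dots> = y mod int Q + int Q * x"
          unfolding x_def by (simp add: distrib_left)
        also have "nat (y mod int Q + int Q * x) = nat (y mod int Q) + Q * nat x"
        proof -
          have "0 \<le> x" using v S by (simp add: shifted_cubes_def x_def y_def)
          then show ?thesis using Q by (simp add: nat_add_distrib nat_mult_distrib)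
        qed
        finally have *: "nat (cube_pt (map2 (\<lambda>x y. int Q * x + y) v e) S + r S)
            = nat (y mod int Q) + Q * nat x" .
        have "nat (y mod int Q) < Q" using Q by (simp add: nat_less_iff)
        from mult[OF this, of "nat x"] show ?thesis
          unfolding * by (simp add: x_def y_def)
      qed
      then show "cube_weight s f (\<lambda>S. cube_pt (map2 (\<lambda>x y. int Q * x + y) v e) S + r S) =
          cube_weight s f (\<lambda>S. (cube_pt e S + r S) mod int Q) *
          cube_weight s (\<lambda>n. f (Q * n)) (\<lambda>S. cube_pt v S + (cube_pt e S + r S) div int Q)"
        unfolding cube_weight_def prod.distrib[symmetric] by (intro prod.cong) auto
    qed
    finally show "(\<Sum>v\<in>{v \<in> shifted_cubes s r M. map (\<lambda>x. x mod int Q) v = e}.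
        cube_weight s f (\<lambda>S. cube_pt v S + r S)) =
      cube_weight s f (\<lambda>S. (cube_pt e S + r S) mod int Q) *
      cube_sum s (\<lambda>n. f (Q * n)) (\<lambda>S. (cube_pt e S + r S) div int Q)
        (\<lambda>S. - (((cube_pt e S + r S) mod int Q - M S) div int Q))"
      by (simp add: cube_sum_def sum_distrib_left)
  qed
  finally show ?thesis .
qed

section \<open>Recursion for the supremum over carries and bounds\<close>

definition admissible :: "nat \<Rightarrow> nat \<Rightarrow> (nat set \<Rightarrow> int) \<Rightarrow> (nat set \<Rightarrow> int) \<Rightarrow> bool" where
  "admissible s N r M \<longleftrightarrow> (\<forall>S. S \<subseteq> {1..s} \<longrightarrow>
     0 \<le> r S \<and> r S \<le> int s \<and> int N \<le> M S \<and> M S \<le> int N + 1)"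

lemma admissibleD:
  assumes "admissible s N r M" "S \<subseteq> {1..s}"
  shows "0 \<le> r S" "r S \<le> int s" "int N \<le> M S" "M S \<le> int N + 1"
  using assms by (simp_all add: admissible_def)

text \<open>A digit step turns constant shifts and bounds into ones that vary with the vertex and
  with the low digits. The supremum forgets this dependence, so that only the truncation N is left
  as a parameter of the recursion.\<close>

definition level_sup :: "nat \<Rightarrow> (nat \<Rightarrow> complex) \<Rightarrow> nat \<Rightarrow> real" where
  "level_sup s f N = (SUP (r, M) \<in> {(r, M). admissible s N r M}. cmod (cube_sum s f r M))"

lemma admissible_trivial: "admissible s N (\<lambda>_. 0) (\<lambda>_. int N)"
  by (simp add: admissible_def)

lemma cmod_cube_sum_le_of_admissible:
  assumes "\<And>n. cmod (f n) = 1" "admissible s N r M"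
  shows "cmod (cube_sum s f r M) \<le> real ((2 * (N + s) + 1) ^ (s + 1))"
  by (rule cmod_cube_sum_le) (use assms in \<open>simp_all add: admissible_def\<close>)

lemma finite_shifted_cubes_of_admissible:
  "admissible s N r M \<Longrightarrow> finite (shifted_cubes s r M)"
  by (rule finite_shifted_cubes[of s r M N]) (simp add: admissible_def)

lemma cmod_cube_sum_le_level_sup:
  assumes "\<And>n. cmod (f n) = 1" "admissible s N r M"
  shows "cmod (cube_sum s f r M) \<le> level_sup s f N"
proof -
  \<comment> \<open>\<open>admissible\<close> leaves the values at sets outside {1..s} free, so the
    index set is infinite and the supremum needs a uniform bound.\<close>
  have "bdd_above ((\<lambda>(r, M). cmod (cube_sum s f r M)) ` {(r, M). admissible s N r M})"
  proof (rule bdd_aboveI2)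
    show "(case p of (r, M) \<Rightarrow> cmod (cube_sum s f r M)) \<le> real ((2 * (N + s) + 1) ^ (s + 1))"
      if "p \<in> {(r, M). admissible s N r M}" for p
      using that cmod_cube_sum_le_of_admissible[of f s N, OF assms(1)] by (cases p) simp
  qed
  then show ?thesis
    unfolding level_sup_def using assms(2)
    by (intro cSUP_upper2[where x = "(r, M)"]) auto
qed

lemma level_sup_le:
  assumes "\<And>r M. admissible s N r M \<Longrightarrow> cmod (cube_sum s f r M) \<le> B"
  shows "level_sup s f N \<le> B"
  unfolding level_sup_def
proof (rule cSUP_least)
  show "{(r, M). admissible s N r M} \<noteq> {}" using admissible_trivial by blast
qed (use assms in auto)

lemma level_sup_nonneg:
  assumes "\<And>n. cmod (f n) = 1"
  shows "0 \<le> level_sup s f N"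
  using cmod_cube_sum_le_level_sup[of f, OF assms admissible_trivial] norm_ge_zero order_trans by blast

lemma cube_pt_digit_vector_bounds:
  assumes e: "e \<in> digit_vectors s Q" and S: "S \<subseteq> {1..s}" and Q: "Q > 0"
  shows "0 \<le> cube_pt e S" "cube_pt e S \<le> (int s + 1) * (int Q - 1)"
proof -
  have le: "length e = s + 1" and e_sub: "set e \<subseteq> {0..<int Q}"
    using e by (simp_all add: digit_vectors_def)
  have rng: "0 \<le> e ! i \<and> e ! i \<le> int Q - 1" if "i < s + 1" for i
    using subsetD[OF e_sub nth_mem[of i e]] that le by simp
  have S': "i < s + 1" if "i \<in> S" for i using that S by auto
  show "0 \<le> cube_pt e S" unfolding cube_pt_def using rng S' by (intro add_nonneg_nonneg sum_nonneg) auto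
  have "(\<Sum>i\<in>S. e ! i) \<le> of_nat (card S) * (int Q - 1)"
    using rng S' by (intro sum_bounded_above) auto
  also have "\<dots> \<le> int s * (int Q - 1)"
    using card_mono[OF _ S] Q by (intro mult_right_mono) auto
  finally show "cube_pt e S \<le> (int s + 1) * (int Q - 1)"
    using rng[of 0] by (simp add: cube_pt_def distrib_right)
qed

text \<open>A cube point of low digits is at most (s + 1)(Q - 1); adding a carry of at most s stays
  below (s + 1) Q, so the next carry is again at most s. For N <= M <= N + 1 and 0 <= d < Q, the
  ceiling of (M - d) / Q is N div Q or N div Q + 1.\<close>

lemma admissible_digit_step:
  assumes adm: "admissible s N r M" and e: "e \<in> digit_vectors s Q" and Q: "Q > 0"
  shows "admissible s (N div Q) (\<lambda>S. (cube_pt e S + r S) div int Q)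
    (\<lambda>S. - (((cube_pt e S + r S) mod int Q - M S) div int Q))"
  unfolding admissible_def
proof (intro allI impI conjI)
  fix S assume S: "S \<subseteq> {1..s}"
  note a = admissibleD[OF adm S] and c = cube_pt_digit_vector_bounds[OF e S Q]
  have Q': "0 < int Q" using Q by simp
  show "0 \<le> (cube_pt e S + r S) div int Q" using a c Q by (simp add: pos_imp_zdiv_nonneg_iff)
  have "cube_pt e S + r S < (int s + 1) * int Q"
    using a c Q by (simp add: algebra_simps)
  then show "(cube_pt e S + r S) div int Q \<le> int s"
    using int_div_less_iff[OF Q', of "cube_pt e S + r S" "int s + 1"] by simp
  define d where "d = (cube_pt e S + r S) mod int Q"
  define n where "n = int (N div Q)"
  have d: "0 \<le> d" "d < int Q" using Q by (simp_all add: d_def)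
  have N: "int N = n * int Q + int (N mod Q)" "int (N mod Q) < int Q" "0 \<le> int (N mod Q)"
    using Q by (simp_all add: n_def flip: of_nat_mult of_nat_add)
  have "d - M S < (- n + 1) * int Q"
    unfolding distrib_right using d a N by simp
  then show "int (N div Q) \<le> - ((d - M S) div int Q)"
    unfolding int_div_less_iff[OF Q', symmetric] n_def by simp
  have "\<not> d - M S < (- n - 1) * int Q"
    unfolding left_diff_distrib using d a N by linarith
  then show "- ((d - M S) div int Q) \<le> int (N div Q) + 1"
    unfolding int_div_less_iff[OF Q', symmetric] n_def by simp
qed

lemma cube_sum_cong:
  assumes "\<And>S. S \<subseteq> {1..s} \<Longrightarrow> r S = r' S" "\<And>S. S \<subseteq> {1..s} \<Longrightarrow> M S = M' S"
  shows "cube_sum s f r M = cube_sum s f r' M'"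
proof -
  have "shifted_cubes s r M = shifted_cubes s r' M'"
    using assms by (simp add: shifted_cubes_def cong: imp_cong)
  moreover have "cube_weight s f (\<lambda>S. cube_pt v S + r S) = cube_weight s f (\<lambda>S. cube_pt v S + r' S)" for v
    unfolding cube_weight_def using assms(1) by (intro prod.cong) auto
  ultimately show ?thesis by (simp add: cube_sum_def)
qed

lemma level_sup_digit_step:
  assumes Q: "Q > 0"
    and mult: "\<And>d n. d < Q \<Longrightarrow> f (d + Q * n) = f d * f (Q * n)"
    and unit: "\<And>n. cmod (f n) = 1"
  shows "level_sup s f N \<le> real (Q ^ (s + 1)) * level_sup s (\<lambda>n. f (Q * n)) (N div Q)"
proof (rule level_sup_le)
  fix r M assume adm: "admissible s N r M"
  have "cmod (cube_sum s f r M) \<le> (\<Sum>e\<in>digit_vectors s Q. level_sup s (\<lambda>n. f (Q * n)) (N div Q))"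
  proof (subst cube_sum_split_digits[of Q f, OF Q mult finite_shifted_cubes_of_admissible[OF adm]],
      assumption, rule sum_norm_le)
    fix e assume e: "e \<in> digit_vectors s Q"
    show "cmod (cube_weight s f (\<lambda>S. (cube_pt e S + r S) mod int Q) *
        cube_sum s (\<lambda>n. f (Q * n)) (\<lambda>S. (cube_pt e S + r S) div int Q)
          (\<lambda>S. - (((cube_pt e S + r S) mod int Q - M S) div int Q)))
      \<le> level_sup s (\<lambda>n. f (Q * n)) (N div Q)"
      unfolding norm_mult cmod_cube_weight[of f, OF unit] mult_1_left
      by (intro cmod_cube_sum_le_level_sup unit admissible_digit_step[OF adm e Q])
  qed
  then show "cmod (cube_sum s f r M) \<le> real (Q ^ (s + 1)) * level_sup s (\<lambda>n. f (Q * n)) (N div Q)"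
    by simp
qed

text \<open>Parallelogram law |1 + u|^2 + |1 - u|^2 = 4 together with sqrt (4 - t) <= 2 - t / 4.
  This turns a difference of two weights into a quadratic saving.\<close>

lemma cmod_one_plus_unit_le:
  assumes "cmod u = 1"
  shows "cmod (1 + u) \<le> 2 - (cmod (1 - u))\<^sup>2 / 4"
proof -
  have "(Re u)\<^sup>2 + (Im u)\<^sup>2 = 1" using assms cmod_power2[of u] by simp
  then have *: "(cmod (1 + u))\<^sup>2 + (cmod (1 - u))\<^sup>2 = 4"
    by (simp add: cmod_power2) (simp add: power2_eq_square algebra_simps)
  have "(2 - (cmod (1 - u))\<^sup>2 / 4)\<^sup>2 = 4 - (cmod (1 - u))\<^sup>2 + ((cmod (1 - u))\<^sup>2 / 4)\<^sup>2"
    by (simp add: power2_eq_square algebra_simps)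
  also have "\<dots> \<ge> (cmod (1 + u))\<^sup>2"
    using * zero_le_power2[of "(cmod (1 - u))\<^sup>2 / 4"] by linarith
  finally have "(cmod (1 + u))\<^sup>2 \<le> (2 - (cmod (1 - u))\<^sup>2 / 4)\<^sup>2" .
  moreover have "0 \<le> 2 - (cmod (1 - u))\<^sup>2 / 4" using * zero_le_power2[of "cmod (1 + u)"] by linarith
  ultimately show ?thesis by (rule power2_le_imp_le)
qed

text \<open>The pair e, e' leads to the same inner cube sum, so its two terms combine into one with
  factor 1 + u, of size at most 2 - \<delta>^2 / 4; the remaining Q^(s + 1) - 2 terms are bounded
  trivially.\<close>

lemma level_sup_gain:
  assumes Q: "Q > 0"
    and mult: "\<And>d n. d < Q \<Longrightarrow> f (d + Q * n) = f d * f (Q * n)"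
    and unit: "\<And>n. cmod (f n) = 1"
    and pair: "\<And>r M. admissible s N r M \<Longrightarrow> \<exists>e\<in>digit_vectors s Q. \<exists>e'\<in>digit_vectors s Q. e \<noteq> e' \<and>
      (\<forall>S. S \<subseteq> {1..s} \<longrightarrow> (cube_pt e S + r S) div int Q = (cube_pt e' S + r S) div int Q \<and>
        ((cube_pt e S + r S) mod int Q - M S) div int Q = ((cube_pt e' S + r S) mod int Q - M S) div int Q) \<and>
      (\<exists>u. cmod u = 1 \<and> cmod (1 - u) = \<delta> \<and>
        cube_weight s f (\<lambda>S. (cube_pt e' S + r S) mod int Q) =
        cube_weight s f (\<lambda>S. (cube_pt e S + r S) mod int Q) * u)"
  shows "level_sup s f N \<le> (real (Q ^ (s + 1)) - \<delta>\<^sup>2 / 4) * level_sup s (\<lambda>n. f (Q * n)) (N div Q)"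
proof (rule level_sup_le)
  fix r M assume adm: "admissible s N r M"
  define A where "A e = cube_sum s (\<lambda>n. f (Q * n)) (\<lambda>S. (cube_pt e S + r S) div int Q)
    (\<lambda>S. - (((cube_pt e S + r S) mod int Q - M S) div int Q))" for e
  define p where "p e = cube_weight s f (\<lambda>S. (cube_pt e S + r S) mod int Q)" for e
  define \<alpha> where "\<alpha> = level_sup s (\<lambda>n. f (Q * n)) (N div Q)"
  let ?E = "digit_vectors s Q"
  have p: "cmod (p e) = 1" for e unfolding p_def by (rule cmod_cube_weight[of f, OF unit])
  have A: "cmod (A e) \<le> \<alpha>" if "e \<in> ?E" for e
    unfolding A_def \<alpha>_def by (intro cmod_cube_sum_le_level_sup unit admissible_digit_step[OF adm that Q])
  obtain e e' u where e: "e \<in> ?E" "e' \<in> ?E" "e \<noteq> e'"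
    and st: "\<forall>S. S \<subseteq> {1..s} \<longrightarrow> (cube_pt e S + r S) div int Q = (cube_pt e' S + r S) div int Q \<and>
        ((cube_pt e S + r S) mod int Q - M S) div int Q = ((cube_pt e' S + r S) mod int Q - M S) div int Q"
    and u: "cmod u = 1" "cmod (1 - u) = \<delta>" "p e' = p e * u"
    using pair[OF adm] unfolding p_def by blast
  have "A e' = A e" unfolding A_def using st by (intro cube_sum_cong) auto
  have \<alpha>0: "0 \<le> \<alpha>" using A[OF e(1)] norm_ge_zero order_trans by blast
  have "cube_sum s f r M = (\<Sum>e\<in>?E. p e * A e)"
    unfolding p_def A_def by (rule cube_sum_split_digits[of Q f, OF Q mult finite_shifted_cubes_of_admissible[OF adm]])
  also have "\<dots> = p e * A e + (p e' * A e' + (\<Sum>x\<in>?E - {e} - {e'}. p x * A x))"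
    using e by (subst sum.remove[of _ e], simp_all) (subst sum.remove[of _ e'], auto)
  also have "\<dots> = p e * (1 + u) * A e + (\<Sum>x\<in>?E - {e} - {e'}. p x * A x)"
    by (simp add: \<open>A e' = A e\<close> u(3) algebra_simps)
  finally have "cmod (cube_sum s f r M) \<le> cmod (p e * (1 + u) * A e) + cmod (\<Sum>x\<in>?E - {e} - {e'}. p x * A x)"
    by (simp only: norm_triangle_ineq)
  also have "cmod (p e * (1 + u) * A e) \<le> (2 - \<delta>\<^sup>2 / 4) * \<alpha>"
    unfolding norm_mult p mult_1_left using cmod_one_plus_unit_le[OF u(1)] A[OF e(1)] \<alpha>0 u(2)
    by (intro mult_mono') auto
  also have "cmod (\<Sum>x\<in>?E - {e} - {e'}. p x * A x) \<le> (\<Sum>x\<in>?E - {e} - {e'}. \<alpha>)"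
    by (rule sum_norm_le) (simp add: norm_mult p A)
  also have "\<dots> = (real (Q ^ (s + 1)) - 2) * \<alpha>"
  proof -
    have "card (?E - {e} - {e'}) = Q ^ (s + 1) - 2"
      using e by (simp add: card_Diff_singleton)
    moreover have "card {e, e'} \<le> card ?E" using e by (intro card_mono) auto
    ultimately show ?thesis using e(3) by (simp add: of_nat_diff)
  qed
  finally have "cmod (cube_sum s f r M) \<le> (2 - \<delta>\<^sup>2 / 4) * \<alpha> + (real (Q ^ (s + 1)) - 2) * \<alpha>" by simp
  then show "cmod (cube_sum s f r M) \<le> (real (Q ^ (s + 1)) - \<delta>\<^sup>2 / 4) * \<alpha>"
    by (simp add: algebra_simps)
qed

section \<open>The gain from a digit defect\<close>

definition digit_defect :: "nat \<Rightarrow> (nat \<Rightarrow> complex) \<Rightarrow> nat \<Rightarrow> nat \<Rightarrow> real" where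
  "digit_defect q f i j = cmod (f (q ^ i * (j + 1)) - f (q ^ i * j) * f (q ^ i))"

lemma q_multiplicative_unit: "q_multiplicative q f \<Longrightarrow> cmod (f n) = 1"
  by (simp add: q_multiplicative_def)

lemma q_multiplicative_add:
  "q_multiplicative q f \<Longrightarrow> m < q ^ t \<Longrightarrow> f (m + q ^ t * n) = f m * f (q ^ t * n)"
  by (simp add: q_multiplicative_def)

lemma cmod_conj_parity_diff: "cmod (1 - conj_parity S z) = cmod (1 - z)"
proof -
  have "1 - cnj z = cnj (1 - z)" by simp
  then show ?thesis unfolding conj_parity_def by (metis complex_mod_cnj id_apply)
qed

text \<open>Pair S with S together with 2: membership of 1 is unchanged while the parity flips, so
  the factors are c and its conjugate. Thus s >= 2 lets a factor that is constant on the face of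
  vertices containing 1 cancel, and only a deviation at a single vertex remains.\<close>

lemma prod_conj_parity_eq_one:
  assumes "s \<ge> 2" and c: "cmod c = 1"
  shows "(\<Prod>S\<in>Pow {1..s}. conj_parity S (if (1::nat) \<in> S then c else 1)) = 1"
proof -
  have ins: "{1..s} = insert 2 ({1..s} - {2})" using assms(1) by auto
  have "(\<Prod>S\<in>Pow {1..s}. conj_parity S (if 1 \<in> S then c else 1)) =
    (\<Prod>S\<in>Pow ({1..s} - {2}). conj_parity S (if 1 \<in> S then c else 1) *
       conj_parity (insert 2 S) (if 1 \<in> insert 2 S then c else 1))"
    by (subst ins, rule prod_Pow_insert) auto
  also have "\<dots> = (\<Prod>S\<in>Pow ({1..s} - {2}). 1)"
  proof (rule prod.cong[OF refl])
    fix S assume S: "S \<in> Pow ({1..s} - {2})"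
    then have "finite S" "2 \<notin> S" using finite_subset by auto
    then have "conj_parity (insert 2 S) c * conj_parity S c = 1"
      using c by (simp add: conj_parity_def complex_norm_square[symmetric] mult.commute)
    then show "conj_parity S (if 1 \<in> S then c else 1) *
       conj_parity (insert 2 S) (if 1 \<in> insert 2 S then c else 1) = 1"
      by (simp add: mult.commute)
  qed
  finally show ?thesis by simp
qed

text \<open>The edges of the cube are chosen so that only its top vertex overflows into the digit at
  position b; that vertex then sees the digit j + 1 while all other vertices see 0 or j.
  The base point h q^{b+2} with h = 0 or 1 keeps all vertices on one side of N mod Q.\<close>

lemma exists_cancelling_pair:
  assumes q: "q \<ge> 2" and s: "s \<ge> 2" and b: "s * s + s \<le> q ^ b"
    and qm: "q_multiplicative q f" and j: "0 < j" "j < q" and adm: "admissible s N r M"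
    and Q_def: "Q = q ^ (b + 3)"
  shows "\<exists>e\<in>digit_vectors s Q. \<exists>e'\<in>digit_vectors s Q. e \<noteq> e' \<and>
      (\<forall>S. S \<subseteq> {1..s} \<longrightarrow> (cube_pt e S + r S) div int Q = (cube_pt e' S + r S) div int Q \<and>
        ((cube_pt e S + r S) mod int Q - M S) div int Q = ((cube_pt e' S + r S) mod int Q - M S) div int Q) \<and>
      (\<exists>u. cmod u = 1 \<and> cmod (1 - u) = digit_defect q f b j \<and>
        cube_weight s f (\<lambda>S. (cube_pt e' S + r S) mod int Q) =
        cube_weight s f (\<lambda>S. (cube_pt e S + r S) mod int Q) * u)"
proof -
  \<comment> \<open>The values \<open>X i S\<close> for i < q lie below q^(b + 2), and Q >= 2 q^(b +
    2) leaves room for two disjoint blocks of that length. The block that does not contain N mod Q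
    by construction is used: the first if N mod Q >= q^(b + 2), otherwise the second.\<close>
  define h :: nat where "h = (if q ^ (b + 2) \<le> N mod Q then 0 else 1)"
  define H where "H = q ^ (b + 2) * h"
  \<comment> \<open>The edges sum to exactly q^b at the full vertex. Leaving out any edge lowers the
    sum by at least s + 1 (for edge 1 this is the hypothesis on b), which is more than a carry of at
    most s can restore. Edge 1 also holds the digit i, to be compared for i = 0 and i = j.\<close>
  define u1 where "u1 = q ^ b - (s - 1) * (s + 1)"
  define vec where "vec i = int H # int (u1 + q ^ b * i) # replicate (s - 1) (int s + 1)" for i
  define w where "w S = (if 1 \<in> S then u1 else 0) + (s + 1) * card (S - {1})" for S :: "nat set"
  define y where "y S = w S + nat (r S)" for S
  define X where "X i S = (if 1 \<in> S then q ^ b * i else 0) + y S" for i S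
  have sq: "(s - 1) * (s + 1) + s + 1 = s * s + s"
    using s by (cases s) (auto simp: algebra_simps)
  have qb0: "0 < q ^ b" using q by simp
  have qq: "q * q ^ b + q ^ b \<le> q ^ (b + 2)"
  proof -
    have "q * q ^ b + q ^ b \<le> q * q ^ b + q * q ^ b" using q by simp
    also have "\<dots> \<le> q * (q * q ^ b)"
      unfolding mult_2[symmetric] using q by (intro mult_right_mono) auto
    finally show ?thesis by (simp add: power_add power2_eq_square mult_ac)
  qed
  have HQ: "H + q ^ (b + 2) \<le> Q"
  proof -
    have "H \<le> q ^ (b + 2)" by (simp add: H_def h_def)
    then have "H + q ^ (b + 2) \<le> 2 * q ^ (b + 2)" by simp
    also have "\<dots> \<le> q * q ^ (b + 2)" using q by (intro mult_right_mono) auto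
    finally show ?thesis by (simp add: Q_def eval_nat_numeral)
  qed
  have w_full: "w {1..s} = q ^ b"
  proof -
    have "card ({1..s} - {1}) = s - 1" using s by (simp add: card_Diff_singleton)
    then show ?thesis using s b sq by (simp add: w_def u1_def mult.commute)
  qed
  have w_lt: "w S + s < q ^ b" if S: "S \<subseteq> {1..s}" "S \<noteq> {1..s}" for S
  proof (cases "1 \<in> S")
    case True
    have fin: "finite S" using S finite_subset by blast
    have "S \<subset> {1..s}" using S by blast
    then have "card S < s" using psubset_card_mono[of "{1..s}" S] by simp
    then have c: "card (S - {1}) \<le> s - 2" using True fin by (simp add: card_Diff_singleton)
    have "(s + 1) * card (S - {1}) \<le> (s + 1) * (s - 2)" using c by (rule mult_le_mono2)
    moreover obtain m where "s = 2 + m" using le_Suc_ex[OF s] by blast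
    then have "(s + 1) * (s - 2) + (s + 1) = (s - 1) * (s + 1)"
      by (simp add: algebra_simps)
    ultimately have "u1 + (s + 1) * card (S - {1}) + s < q ^ b"
      using b sq unfolding u1_def by linarith
    then show ?thesis using True by (simp add: w_def)
  next
    case False
    have "card (S - {1}) \<le> card ({1..s} - {1})" using S by (intro card_mono) auto
    then have "card (S - {1}) \<le> s - 1" using s by (simp add: card_Diff_singleton)
    then have "(s + 1) * card (S - {1}) \<le> (s + 1) * (s - 1)" by (rule mult_le_mono2)
    then show ?thesis using False b sq by (simp add: w_def mult.commute)
  qed
  have rS: "0 \<le> r S" "nat (r S) \<le> s" if "S \<subseteq> {1..s}" for S
    using admissibleD[OF adm that] by auto
  have s_lt: "s < q ^ b"
  proof -
    have "0 < s * s" using s by simp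
    then show ?thesis using b by linarith
  qed
  have y_lt: "y S < q ^ b" if S: "S \<subseteq> {1..s}" "S \<noteq> {1..s}" for S
    using w_lt[OF S] rS(2)[OF S(1)] by (simp add: y_def)
  have y_le: "y S \<le> q ^ b + s" if S: "S \<subseteq> {1..s}" for S
    using y_lt[OF S] rS(2)[OF S] w_full by (cases "S = {1..s}") (auto simp: y_def)
  have X_lt: "X i S < q ^ (b + 2)" if "S \<subseteq> {1..s}" "i < q" for i S
  proof -
    have "(if 1 \<in> S then q ^ b * i else 0) + q ^ b \<le> q * q ^ b"
    proof -
      have "q ^ b * (i + 1) \<le> q ^ b * q" using that by (intro mult_le_mono2) simp
      then show ?thesis by (auto simp: algebra_simps)
    qed
    then show ?thesis using y_le[OF that(1)] s_lt qq by (simp add: X_def)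
  qed
  have pt: "cube_pt (vec i) S + r S = int (H + X i S)" if S: "S \<subseteq> {1..s}" for i S
  proof -
    have fin: "finite S" using S finite_subset by blast
    have rest: "(\<Sum>k\<in>S - {1}. vec i ! k) = int ((s + 1) * card (S - {1}))"
    proof -
      have "vec i ! k = int s + 1" if "k \<in> S - {1}" for k
      proof -
        have "k \<in> {1..s}" "k \<noteq> 1" using that S by blast+
        then have "k \<ge> 2" "k \<le> s" by auto
        moreover obtain k' where "k = 2 + k'" using le_Suc_ex[OF \<open>k \<ge> 2\<close>] by blast
        then have "k = Suc (Suc k')" by simp
        ultimately show ?thesis using \<open>k \<le> s\<close> by (simp add: vec_def)
      qed
      then have "(\<Sum>k\<in>S - {1}. vec i ! k) = (\<Sum>k\<in>S - {1}. int s + 1)" by (intro sum.cong) auto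
      then show ?thesis by (simp add: algebra_simps)
    qed
    have "(\<Sum>k\<in>S. vec i ! k) = (if 1 \<in> S then int (u1 + q ^ b * i) else 0) + int ((s + 1) * card (S - {1}))"
    proof (cases "1 \<in> S")
      case True
      then have "(\<Sum>k\<in>S. vec i ! k) = vec i ! 1 + (\<Sum>k\<in>S - {1}. vec i ! k)"
        using fin by (simp add: sum.remove)
      then show ?thesis using True rest by (simp add: vec_def)
    next
      case False
      then have "S - {1} = S" by blast
      then show ?thesis using False rest by simp
    qed
    then show ?thesis using rS(1)[OF S] by (simp add: cube_pt_def vec_def X_def y_def w_def)
  qed
  have vec_mem: "vec i \<in> digit_vectors s Q" if "i < q" for i
  proof -
    have "u1 + q ^ b * i < Q"
    proof -
      have "q ^ b * (i + 1) \<le> q ^ b * q" using that by (intro mult_le_mono2) simp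
      moreover have "u1 \<le> q ^ b" by (simp add: u1_def)
      ultimately have "u1 + q ^ b * i \<le> q * q ^ b" by (simp add: algebra_simps)
      then show ?thesis using qq HQ qb0 by linarith
    qed
    moreover have "0 < q * q ^ b" using qb0 q by simp
    then have "s + 1 < Q" "H < Q" using s_lt qq HQ by linarith+
    ultimately show ?thesis
      using s by (auto simp: vec_def digit_vectors_def simp del: of_nat_add)
  qed
  have div0: "(cube_pt (vec i) S + r S) div int Q = 0"
    and mod0: "(cube_pt (vec i) S + r S) mod int Q = int (H + X i S)"
    if "S \<subseteq> {1..s}" "i < q" for i S
    using X_lt[OF that] HQ by (simp_all add: pt[OF that(1)] del: of_nat_add)
  \<comment> \<open>The right-hand side depends neither on i nor on S. The remainders stay strictly
    on one side of N mod Q, and this strictness absorbs the choice between N and N + 1 for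
    \<open>M S\<close>.\<close>
  have bound: "(int (H + X i S) - M S) div int Q = - int (N div Q) - (if h = 0 then 1 else 0)"
    if S: "S \<subseteq> {1..s}" "i < q" for i S
  proof -
    define n c where "n = int (N div Q)" and "c = int (N mod Q)"
    have Q0: "0 < int Q" using q by (simp add: Q_def)
    have N: "int N = n * int Q + c" unfolding n_def c_def by (simp flip: of_nat_mult of_nat_add)
    have c: "c < int Q" "0 \<le> c" using Q0 by (simp_all add: c_def)
    note MS = admissibleD(3,4)[OF adm S(1)]
    have XQ: "int (X i S) < int (q ^ (b + 2))" using X_lt[OF S] by (simp only: of_nat_less_iff)
    show ?thesis
    proof (cases "h = 0")
      case True
      then have "q ^ (b + 2) \<le> N mod Q" unfolding h_def by (simp split: if_splits)
      then have "int (q ^ (b + 2)) \<le> c" unfolding c_def of_nat_le_iff .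
      moreover have "H = 0" using True by (simp add: H_def)
      ultimately have l: "int (H + X i S) - M S < (- n) * int Q" "\<not> int (H + X i S) - M S < (- n - 1) * int Q"
        unfolding left_diff_distrib using MS N c XQ by (simp_all del: of_nat_power)
      show ?thesis using True l[folded int_div_less_iff[OF Q0]] by (simp add: n_def)
    next
      case False
      then have "\<not> q ^ (b + 2) \<le> N mod Q" unfolding h_def by (simp split: if_splits)
      then have "c < int (q ^ (b + 2))" unfolding c_def of_nat_less_iff by simp
      moreover have "int H = int (q ^ (b + 2))" using False by (simp add: H_def h_def split: if_splits)
      moreover have "int H + int (q ^ (b + 2)) \<le> int Q" using HQ by (simp only: of_nat_le_iff flip: of_nat_add)
      ultimately have l: "int (H + X i S) - M S < (- n + 1) * int Q" "\<not> int (H + X i S) - M S < (- n) * int Q"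
        unfolding distrib_right using MS N c XQ by (simp_all del: of_nat_power)
      show ?thesis using False l[folded int_div_less_iff[OF Q0]] by (simp add: n_def)
    qed
  qed
  \<comment> \<open>From i = 0 to i = j, the part of a vertex from position b upwards goes from 0 to
    j if it contains 1 and does not overflow, but from 1 to j + 1 at the full vertex. So f gains
    \<open>f (q ^ b * j)\<close> on the whole face, and \<zeta> is the extra ratio at the full
    vertex.\<close>
  define \<zeta> where "\<zeta> = f (q ^ b * (j + 1)) / (f (q ^ b) * f (q ^ b * j))"
  note unit = q_multiplicative_unit[OF qm]
  have nz: "f n \<noteq> 0" for n using unit[of n] by auto
  have cz: "cmod \<zeta> = 1" by (simp add: \<zeta>_def norm_divide norm_mult unit)
  have defect: "cmod (1 - \<zeta>) = digit_defect q f b j"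
  proof -
    have "1 - \<zeta> = (f (q ^ b * j) * f (q ^ b) - f (q ^ b * (j + 1))) / (f (q ^ b) * f (q ^ b * j))"
      unfolding \<zeta>_def using nz by (simp add: diff_divide_distrib)
    then show ?thesis
      unfolding digit_defect_def by (simp add: norm_divide norm_mult unit norm_minus_commute)
  qed
  have fX: "f (H + X j S) = f (H + X 0 S) * (if 1 \<in> S then f (q ^ b * j) else 1) *
      (if S = {1..s} then \<zeta> else 1)" if S: "S \<subseteq> {1..s}" for S
  proof -
    have fH: "f (H + X i S) = f (X i S) * f H" if "i < q" for i
      using q_multiplicative_add[OF qm X_lt[OF S that], of h] by (simp add: H_def add.commute)
    have "f (X j S) = f (X 0 S) * (if 1 \<in> S then f (q ^ b * j) else 1) * (if S = {1..s} then \<zeta> else 1)"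
    proof (cases "S = {1..s}")
      case False
      then show ?thesis
        using q_multiplicative_add[OF qm y_lt[OF S False], of j] by (simp add: X_def add.commute)
    next
      case True
      then have 1: "1 \<in> S" using s by simp
      have rl: "nat (r S) < q ^ b" using rS(2)[OF S] s_lt by linarith
      have "f (X i S) = f (nat (r S)) * f (q ^ b * (i + 1))" for i
        using q_multiplicative_add[OF qm rl, of "i + 1"] 1 True w_full
        by (simp add: X_def y_def algebra_simps)
      from this[of j] this[of 0] show ?thesis using 1 True nz by (simp add: \<zeta>_def)
    qed
    then show ?thesis using fH[of j] fH[of 0] j by simp
  qed
  have weight: "cube_weight s f (\<lambda>S. (cube_pt (vec j) S + r S) mod int Q) =
      cube_weight s f (\<lambda>S. (cube_pt (vec 0) S + r S) mod int Q) * conj_parity {1..s} \<zeta>"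
  proof -
    have "cube_weight s f (\<lambda>S. (cube_pt (vec j) S + r S) mod int Q) =
        (\<Prod>S\<in>Pow {1..s}. conj_parity S (f (H + X j S)))"
      unfolding cube_weight_def using j by (intro prod.cong refl) (simp add: mod0 del: of_nat_add)
    also have "\<dots> = (\<Prod>S\<in>Pow {1..s}. conj_parity S (f (H + X 0 S)) *
        conj_parity S (if 1 \<in> S then f (q ^ b * j) else 1) *
        (if S = {1..s} then conj_parity S \<zeta> else 1))"
      by (intro prod.cong) (auto simp: fX)
    also have "\<dots> = (\<Prod>S\<in>Pow {1..s}. conj_parity S (f (H + X 0 S))) * 1 * conj_parity {1..s} \<zeta>"
      unfolding prod.distrib prod_conj_parity_eq_one[OF s unit] by (simp add: prod.delta)
    also have "(\<Prod>S\<in>Pow {1..s}. conj_parity S (f (H + X 0 S))) =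
        cube_weight s f (\<lambda>S. (cube_pt (vec 0) S + r S) mod int Q)"
      unfolding cube_weight_def using j by (intro prod.cong refl) (simp add: mod0 del: of_nat_add)
    finally show ?thesis by simp
  qed
  have "vec 0 \<noteq> vec j" using j q by (simp add: vec_def)
  moreover have "vec 0 \<in> digit_vectors s Q" "vec j \<in> digit_vectors s Q" using vec_mem j by auto
  moreover have "(cube_pt (vec 0) S + r S) div int Q = (cube_pt (vec j) S + r S) div int Q \<and>
      ((cube_pt (vec 0) S + r S) mod int Q - M S) div int Q = ((cube_pt (vec j) S + r S) mod int Q - M S) div int Q"
    if "S \<subseteq> {1..s}" for S
    using that j by (simp only: div0 mod0 bound)
  moreover have "cmod (conj_parity {1..s} \<zeta>) = 1" "cmod (1 - conj_parity {1..s} \<zeta>) = digit_defect q f b j"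
    using cz defect by (simp_all add: cmod_conj_parity_diff)
  ultimately show ?thesis using weight by blast
qed

section \<open>Iteration over the digit positions and the upper bound for the U^s average\<close>

lemma q_multiplicative_scale:
  assumes "q_multiplicative q f" "q \<ge> 1"
  shows "q_multiplicative q (\<lambda>n. f (q ^ i * n))"
  unfolding q_multiplicative_def
proof (intro conjI allI impI)
  fix t m n :: nat assume m: "m < q ^ t" and n: "q ^ t dvd n"
  have "q ^ i * m < q ^ (i + t)" using m assms(2) by (simp add: power_add)
  moreover have "q ^ (i + t) dvd q ^ i * n" using n by (simp add: power_add)
  ultimately show "f (q ^ i * (m + n)) = f (q ^ i * m) * f (q ^ i * n)"
    using assms(1) unfolding q_multiplicative_def distrib_left by blast
qed (use q_multiplicative_unit[OF assms(1)] in simp)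

lemma digit_defect_scale: "digit_defect q (\<lambda>n. f (q ^ i * n)) b j = digit_defect q f (i + b) j"
  by (simp only: digit_defect_def power_add mult.assoc)

definition total_defect :: "nat \<Rightarrow> (nat \<Rightarrow> complex) \<Rightarrow> nat \<Rightarrow> real" where
  "total_defect q f i = (\<Sum>j<q. digit_defect q f i j)"

lemma total_defect_scale: "total_defect q (\<lambda>n. f (q ^ i * n)) b = total_defect q f (i + b)"
  by (simp add: total_defect_def digit_defect_scale)

lemma digit_defect_nonneg: "0 \<le> digit_defect q f i j"
  by (simp add: digit_defect_def)

lemma total_defect_nonneg: "0 \<le> total_defect q f i"
  unfolding total_defect_def by (intro sum_nonneg digit_defect_nonneg)

text \<open>The bound for the cube sum of f after i digits have been split off trivially. In this
  normalisation a trivial digit step is monotonicity in i, and every gain is a factor below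
  1.\<close>

definition level_bound :: "nat \<Rightarrow> nat \<Rightarrow> (nat \<Rightarrow> complex) \<Rightarrow> nat \<Rightarrow> nat \<Rightarrow> real" where
  "level_bound q s f N i = real (q ^ (i * (s + 1))) * level_sup s (\<lambda>n. f (q ^ i * n)) (N div q ^ i)"

lemma level_bound_nonneg:
  assumes "q_multiplicative q f"
  shows "0 \<le> level_bound q s f N i"
  unfolding level_bound_def
  using q_multiplicative_unit[OF assms] by (intro mult_nonneg_nonneg level_sup_nonneg) auto

lemma level_bound_Suc:
  assumes q: "q \<ge> 2" and qm: "q_multiplicative q f"
  shows "level_bound q s f N i \<le> level_bound q s f N (i + 1)"
proof -
  let ?g = "\<lambda>n. f (q ^ i * n)"
  have g: "q_multiplicative q ?g" using qm q by (intro q_multiplicative_scale) auto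
  have "level_sup s ?g (N div q ^ i) \<le>
      real (q ^ (s + 1)) * level_sup s (\<lambda>n. ?g (q * n)) (N div q ^ i div q)"
    using q q_multiplicative_add[OF g, of _ 1] q_multiplicative_unit[OF g]
    by (intro level_sup_digit_step) auto
  then have "real (q ^ (i * (s + 1))) * level_sup s ?g (N div q ^ i) \<le> real (q ^ (i * (s + 1))) *
      (real (q ^ (s + 1)) * level_sup s (\<lambda>n. ?g (q * n)) (N div q ^ i div q))"
    by (intro mult_left_mono) auto
  moreover have 1: "N div q ^ (i + 1) = N div q ^ i div q"
    by (simp add: div_mult2_eq[symmetric] mult.commute)
  moreover have 2: "q ^ ((i + 1) * (s + 1)) = q ^ (i * (s + 1)) * q ^ (s + 1)"
    by (simp only: power_add[symmetric] distrib_right mult_1)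
  moreover have 3: "(\<lambda>n. f (q ^ (i + 1) * n)) = (\<lambda>n. f (q ^ i * (q * n)))"
    by (simp add: mult_ac)
  ultimately show ?thesis
    unfolding level_bound_def 1 2 3 of_nat_mult mult.assoc by simp
qed

lemma level_bound_mono:
  assumes "q \<ge> 2" "q_multiplicative q f" "i \<le> i'"
  shows "level_bound q s f N i \<le> level_bound q s f N i'"
  using assms(3) by (rule lift_Suc_mono_le[rotated]) (use level_bound_Suc[OF assms(1,2)] in simp)

text \<open>Some digit j has defect at least \<open>total_defect\<close> / q, which accounts for the
  q^2 in the constant; the 4 comes from the saving \<delta>^2 / 4, and q^((b + 3)(s + 1)) is the
  number of low parts among which a single pair improves. The bound 1 - t <= exp (- t) makes gains
  multiply. For j = 0 the defect vanishes since f 0 = 1, and the trivial step suffices.\<close>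

lemma level_bound_gain:
  assumes q: "q \<ge> 2" and s: "s \<ge> 2" and b: "s * s + s \<le> q ^ b" and qm: "q_multiplicative q f"
  shows "level_bound q s f N i \<le>
    exp (- (total_defect q f (i + b))\<^sup>2 / (4 * real q ^ 2 * real q ^ ((b + 3) * (s + 1)))) *
    level_bound q s f N (i + (b + 3))"
proof -
  let ?g = "\<lambda>n. f (q ^ i * n)"
  define Q where "Q = q ^ (b + 3)"
  define A where "A = level_sup s (\<lambda>n. ?g (Q * n)) (N div q ^ i div Q)"
  define d where "d = total_defect q f (i + b)"
  have g: "q_multiplicative q ?g" using qm q by (intro q_multiplicative_scale) auto
  note unit = q_multiplicative_unit[OF g]
  have Q0: "Q > 0" using q by (simp add: Q_def)
  have A0: "0 \<le> A" unfolding A_def by (rule level_sup_nonneg) (rule unit)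
  have mult: "?g (x + Q * n) = ?g x * ?g (Q * n)" if "x < Q" for x n
    using q_multiplicative_add[OF g] that unfolding Q_def by blast
  have "\<exists>j<q. d / real q \<le> digit_defect q ?g b j"
  proof (rule ccontr)
    assume "\<not> ?thesis"
    then have "(\<Sum>j<q. digit_defect q ?g b j) < (\<Sum>j<q. d / real q)"
      using q by (intro sum_strict_mono) (auto simp: not_le lessThan_empty_iff)
    then show False using q by (simp add: d_def total_defect_def digit_defect_scale)
  qed
  then obtain j where j: "j < q" "d / real q \<le> digit_defect q ?g b j" by blast
  define \<delta> where "\<delta> = digit_defect q ?g b j"
  have d0: "0 \<le> d" unfolding d_def by (rule total_defect_nonneg)
  have "level_sup s ?g (N div q ^ i) \<le> (real (Q ^ (s + 1)) - \<delta>\<^sup>2 / 4) * A"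
  proof (cases "j = 0")
    case True
    have "?g 0 = 1"
    proof -
      have "?g (0 + Q * 0) = ?g 0 * ?g (Q * 0)" using Q0 by (intro mult)
      moreover have "?g 0 \<noteq> 0" using unit[of 0] by auto
      ultimately show ?thesis by simp
    qed
    then have "\<delta> = 0" using True by (simp add: \<delta>_def digit_defect_def)
    then show ?thesis unfolding A_def using level_sup_digit_step[of Q ?g, OF Q0 mult unit] by simp
  next
    case False
    show ?thesis unfolding A_def \<delta>_def
      using exists_cancelling_pair[OF q s b g _ j(1) _ Q_def] False
      by (intro level_sup_gain Q0 mult unit) auto
  qed
  also have "\<dots> \<le> (real (Q ^ (s + 1)) - (d / real q)\<^sup>2 / 4) * A"
    using j(2) d0 A0 unfolding \<delta>_def by (intro mult_right_mono diff_left_mono divide_right_mono power_mono) auto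
  also have "\<dots> = real (Q ^ (s + 1)) * (1 - d\<^sup>2 / (4 * real q ^ 2 * real q ^ ((b + 3) * (s + 1)))) * A"
  proof -
    have E: "real q ^ ((b + 3) * (s + 1)) = real (Q ^ (s + 1))"
      unfolding Q_def power_mult by simp
    have "real (Q ^ (s + 1)) > 0" using Q0 by simp
    then show ?thesis unfolding E using q Q0 by (simp add: power_divide right_diff_distrib)
  qed
  also have "\<dots> \<le> real (Q ^ (s + 1)) * exp (- (d\<^sup>2 / (4 * real q ^ 2 * real q ^ ((b + 3) * (s + 1))))) * A"
    using exp_ge_add_one_self[of "- (d\<^sup>2 / (4 * real q ^ 2 * real q ^ ((b + 3) * (s + 1))))"] A0
    by (intro mult_right_mono mult_left_mono) auto
  finally have "level_sup s ?g (N div q ^ i) \<le>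
    real (Q ^ (s + 1)) * exp (- (d\<^sup>2 / (4 * real q ^ 2 * real q ^ ((b + 3) * (s + 1))))) * A" .
  then have "level_bound q s f N i \<le> real (q ^ (i * (s + 1))) * (real (Q ^ (s + 1)) *
      exp (- (d\<^sup>2 / (4 * real q ^ 2 * real q ^ ((b + 3) * (s + 1))))) * A)"
    unfolding level_bound_def by (intro mult_left_mono) auto
  also have "\<dots> = exp (- (d\<^sup>2 / (4 * real q ^ 2 * real q ^ ((b + 3) * (s + 1))))) *
      (real (q ^ (i * (s + 1)) * Q ^ (s + 1)) * A)" by (simp add: mult_ac)
  also have "real (q ^ (i * (s + 1)) * Q ^ (s + 1)) * A = level_bound q s f N (i + (b + 3))"
  proof -
    have "q ^ (i * (s + 1)) * Q ^ (s + 1) = q ^ ((i + (b + 3)) * (s + 1))"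
      unfolding Q_def power_mult[symmetric] power_add[symmetric] by (simp only: distrib_right)
    moreover have "A = level_sup s (\<lambda>n. f (q ^ (i + (b + 3)) * n)) (N div q ^ (i + (b + 3)))"
      unfolding A_def Q_def by (simp only: power_add[of q i] div_mult2_eq mult.assoc)
    ultimately show ?thesis unfolding level_bound_def by simp
  qed
  finally show ?thesis by (simp add: d_def)
qed

text \<open>A single chain of blocks of b + 3 digits would read only the defects in one residue
  class modulo b + 3. For the product over b + 3 consecutive levels, moving the window by one
  replaces the factor at T by the one at T + b + 3 and collects the defect at T + b, so every
  position counts.\<close>

lemma level_bound_prod_le:
  assumes q: "q \<ge> 2" and s: "s \<ge> 2" and b: "s * s + s \<le> q ^ b" and qm: "q_multiplicative q f"
    and c: "c = 1 / (4 * real q ^ 2 * real q ^ ((b + 3) * (s + 1)))"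
  shows "(\<Prod>o'<b + 3. level_bound q s f N o') \<le>
    exp (- c * (\<Sum>i<T. (total_defect q f (i + b))\<^sup>2)) * (\<Prod>o'<b + 3. level_bound q s f N (T + o'))"
proof (induction T)
  case 0
  then show ?case by simp
next
  case (Suc T)
  let ?\<beta> = "level_bound q s f N"
  have k: "b + 3 = Suc (b + 2)" by simp
  have gain: "?\<beta> T \<le> exp (- c * (total_defect q f (T + b))\<^sup>2) * ?\<beta> (T + (b + 3))"
    using level_bound_gain[OF q s b qm, of N T] by (simp add: c)
  have "(\<Prod>o'<b + 3. ?\<beta> (T + o')) = ?\<beta> T * (\<Prod>o'<b + 2. ?\<beta> (Suc T + o'))"
    unfolding k prod.lessThan_Suc_shift by simp
  also have "\<dots> \<le> (exp (- c * (total_defect q f (T + b))\<^sup>2) * ?\<beta> (T + (b + 3))) *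
      (\<Prod>o'<b + 2. ?\<beta> (Suc T + o'))"
    by (intro mult_right_mono gain prod_nonneg) (auto intro: level_bound_nonneg[OF qm])
  also have "\<dots> = exp (- c * (total_defect q f (T + b))\<^sup>2) * (\<Prod>o'<b + 3. ?\<beta> (Suc T + o'))"
    unfolding k prod.lessThan_Suc by (simp add: mult_ac)
  finally have "exp (- c * (\<Sum>i<T. (total_defect q f (i + b))\<^sup>2)) * (\<Prod>o'<b + 3. ?\<beta> (T + o')) \<le>
     exp (- c * (\<Sum>i<T. (total_defect q f (i + b))\<^sup>2)) *
     (exp (- c * (total_defect q f (T + b))\<^sup>2) * (\<Prod>o'<b + 3. ?\<beta> (Suc T + o')))"
    by (intro mult_left_mono) auto
  also have "\<dots> = exp (- c * (\<Sum>i<Suc T. (total_defect q f (i + b))\<^sup>2)) * (\<Prod>o'<b + 3. ?\<beta> (Suc T + o'))"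
    by (simp add: distrib_left exp_add[symmetric] algebra_simps)
  finally show ?case using Suc.IH by linarith
qed

text \<open>A box of side m = ceiling (N / (s + 1)) fits: s + 1 coordinates of size at most m - 1
  add up to at most N - 1.\<close>

lemma card_Pi_set_ge:
  assumes "N \<ge> 1"
  shows "(real N / real (s + 1)) ^ (s + 1) \<le> real (card (Pi_set s N))"
proof -
  define m where "m = (N - 1) div (s + 1) + 1"
  have fin: "finite (Pi_set s N)"
    unfolding Pi_set_eq_shifted_cubes by (rule finite_shifted_cubes_of_admissible[OF admissible_trivial])
  have m0: "m > 0" by (simp add: m_def)
  have "digit_vectors s m \<subseteq> Pi_set s N"
  proof
    fix v assume v: "v \<in> digit_vectors s m"
    have "(int s + 1) * (int m - 1) < int N"
    proof -
      have "(s + 1) * (m - 1) \<le> N - 1" unfolding m_def by (simp del: mult_Suc)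
      then have "int ((s + 1) * (m - 1)) < int N" using assms by linarith
      then show ?thesis using m0 by (cases m) (auto simp: algebra_simps)
    qed
    then have "0 \<le> cube_pt v S \<and> cube_pt v S < int N" if "S \<subseteq> {1..s}" for S
      using cube_pt_digit_vector_bounds[OF v that m0] by linarith
    then show "v \<in> Pi_set s N" using v by (simp add: Pi_set_def digit_vectors_def)
  qed
  from card_mono[OF fin this] have le: "m ^ (s + 1) \<le> card (Pi_set s N)" by simp
  have "N \<le> m * (s + 1)"
  proof -
    have "N - 1 = (N - 1) div (s + 1) * (s + 1) + (N - 1) mod (s + 1)"
      by (rule div_mult_mod_eq[symmetric])
    moreover have "(N - 1) mod (s + 1) \<le> s" using less_Suc_eq_le by fastforce
    ultimately show ?thesis unfolding m_def distrib_right mult_1 using assms by linarith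
  qed
  then have "real N / real (s + 1) \<le> real m"
    by (simp add: pos_divide_le_eq flip: of_nat_mult del: of_nat_Suc of_nat_add)
  then have "(real N / real (s + 1)) ^ (s + 1) \<le> real m ^ (s + 1)" by (intro power_mono) auto
  also have "\<dots> \<le> real (card (Pi_set s N))" using le by (simp only: of_nat_power[symmetric] of_nat_le_iff)
  finally show ?thesis .
qed

lemma gowers_avg_upper_bound:
  assumes q: "q \<ge> 2" and s: "s \<ge> 2"
  obtains b and c C :: real where "c > 0" "C > 0"
    "\<And>f N T. \<lbrakk>q_multiplicative q f; q ^ T \<le> N; N < q ^ (T + 1)\<rbrakk> \<Longrightarrow>
       cmod (gowers_avg s N f) \<le> C * exp (- c * (\<Sum>i<T. (total_defect q f (i + b))\<^sup>2))"
proof -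
  define b where "b = s * s + s"
  have b: "s * s + s \<le> q ^ b"
    unfolding b_def using q by (intro less_imp_le power_gt_expt) auto
  define k where "k = b + 3"
  define c where "c = 1 / (4 * real q ^ 2 * real q ^ ((b + 3) * (s + 1)))"
  have c0: "c > 0" using q by (simp add: c_def)
  \<comment> \<open>From level T on the truncation is at most q, where cubes are counted trivially;
    the factor q^k covers the passage from q^T to q^(T + o') for o' < k.\<close>
  define B where "B = real (q ^ k) * real (2 * (q + s) + 1)"
  have B0: "B > 0" using q by (simp add: B_def)
  show ?thesis
  proof (rule that[of "c / real k" "(B * real (s + 1)) ^ (s + 1)" b])
    show "c / real k > 0" using c0 by (simp add: k_def)
    show "(B * real (s + 1)) ^ (s + 1) > 0" using B0 by simp
    fix f N T
    assume qm: "q_multiplicative q f" and N: "q ^ T \<le> N" "N < q ^ (T + 1)"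
    define \<Sigma> where "\<Sigma> = (\<Sum>i<T. (total_defect q f (i + b))\<^sup>2)"
    let ?\<beta> = "level_bound q s f N"
    have N1: "N \<ge> 1" using N(1) q by (meson le_trans one_le_power order_trans one_le_numeral)
    have top: "?\<beta> (T + o') \<le> (real N * B) ^ (s + 1)" if "o' < k" for o'
    proof -
      define n where "n = N div q ^ (T + o')"
      have "n \<le> N div q ^ T" unfolding n_def by (simp add: power_add div_mult2_eq)
      also have "\<dots> < q" using N(2) q by (simp add: div_less_iff_less_mult)
      finally have n: "n \<le> q" by simp
      have "level_sup s (\<lambda>n. f (q ^ (T + o') * n)) n \<le> real ((2 * (n + s) + 1) ^ (s + 1))"
        by (intro level_sup_le cmod_cube_sum_le_of_admissible q_multiplicative_unit[OF qm])
      also have "\<dots> \<le> real ((2 * (q + s) + 1) ^ (s + 1))"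
        unfolding of_nat_le_iff using n by (intro power_mono) auto
      finally have "?\<beta> (T + o') \<le> real (q ^ ((T + o') * (s + 1))) * real ((2 * (q + s) + 1) ^ (s + 1))"
        unfolding level_bound_def n_def by (intro mult_left_mono) auto
      also have "\<dots> = (real (q ^ (T + o')) * real (2 * (q + s) + 1)) ^ (s + 1)"
        unfolding power_mult_distrib of_nat_power power_mult by simp
      also have "\<dots> \<le> (real N * B) ^ (s + 1)"
      proof (rule power_mono)
        have "q ^ (T + o') \<le> N * q ^ k"
          unfolding power_add using N(1) that q by (intro mult_mono power_increasing) auto
        then have "real (q ^ (T + o')) \<le> real N * real (q ^ k)" by (simp only: of_nat_le_iff of_nat_mult[symmetric])
        then show "real (q ^ (T + o')) * real (2 * (q + s) + 1) \<le> real N * B"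
          unfolding B_def mult.assoc[symmetric] by (intro mult_right_mono) auto
      qed simp
      finally show ?thesis .
    qed
    \<comment> \<open>Level 0 is below each of the first k levels, so its k-th power is below their
      product. Taking the k-th root afterwards divides the rate c by k.\<close>
    have "?\<beta> 0 ^ k = (\<Prod>o'<k. ?\<beta> 0)" by simp
    also have "\<dots> \<le> (\<Prod>o'<k. ?\<beta> o')"
      by (intro prod_mono conjI level_bound_nonneg[OF qm] level_bound_mono[OF q qm]) auto
    also have "\<dots> \<le> exp (- c * \<Sigma>) * (\<Prod>o'<k. ?\<beta> (T + o'))"
      unfolding k_def \<Sigma>_def by (rule level_bound_prod_le[OF q s b qm c_def])
    also have "\<dots> \<le> exp (- c * \<Sigma>) * (\<Prod>o'<k. (real N * B) ^ (s + 1))"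
      by (intro mult_left_mono prod_mono conjI level_bound_nonneg[OF qm] top) auto
    also have "\<dots> = (exp (- c / real k * \<Sigma>) * (real N * B) ^ (s + 1)) ^ k"
    proof -
      have "exp (- c * \<Sigma>) = exp (real k * (- c / real k * \<Sigma>))" by (simp add: k_def)
      also have "\<dots> = exp (- c / real k * \<Sigma>) ^ k" by (rule exp_of_nat_mult)
      finally show ?thesis by (simp add: power_mult_distrib)
    qed
    finally have "?\<beta> 0 \<le> exp (- c / real k * \<Sigma>) * (real N * B) ^ (s + 1)"
      using B0 by (subst (asm) power_mono_iff) (auto simp: k_def level_bound_nonneg[OF qm])
    moreover have "cmod (cube_sum s f (\<lambda>_. 0) (\<lambda>_. int N)) \<le> ?\<beta> 0"
      using cmod_cube_sum_le_level_sup[of f, OF q_multiplicative_unit[OF qm] admissible_trivial]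
      by (simp add: level_bound_def)
    ultimately have num: "cmod (cube_sum s f (\<lambda>_. 0) (\<lambda>_. int N)) \<le>
        exp (- c / real k * \<Sigma>) * (real N * B) ^ (s + 1)" by linarith
    have "cmod (gowers_avg s N f) = cmod (cube_sum s f (\<lambda>_. 0) (\<lambda>_. int N)) / real (card (Pi_set s N))"
      by (simp add: gowers_avg_eq_cube_sum norm_divide)
    also have "\<dots> \<le> exp (- c / real k * \<Sigma>) * (real N * B) ^ (s + 1) / (real N / real (s + 1)) ^ (s + 1)"
      using num card_Pi_set_ge[OF N1, of s] N1 by (intro frac_le) (auto intro!: mult_nonneg_nonneg simp: B0 less_imp_le)
    also have "\<dots> = exp (- c / real k * \<Sigma>) * ((real N * B) / (real N / real (s + 1))) ^ (s + 1)"
      by (simp only: power_divide times_divide_eq_right)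
    also have "(real N * B) / (real N / real (s + 1)) = B * real (s + 1)"
      using N1 by simp
    finally show "cmod (gowers_avg s N f) \<le> (B * real (s + 1)) ^ (s + 1) *
        exp (- (c / real k) * (\<Sum>i<T. (total_defect q f (i + b))\<^sup>2))"
      by (simp add: \<Sigma>_def mult.commute)
  qed
qed

section \<open>Correlation with a linear phase\<close>

lemma cmod_cis_minus_one: "(cmod (cis t - 1))\<^sup>2 = 2 - 2 * cos t"
proof -
  have "(cmod (cis t - 1))\<^sup>2 = (cos t - 1)\<^sup>2 + (sin t)\<^sup>2" by (simp add: cmod_power2)
  also have "\<dots> = (sin t)\<^sup>2 + (cos t)\<^sup>2 + 1 - 2 * cos t" by (simp add: power2_eq_square algebra_simps)
  finally show ?thesis by simp
qed

lemma Re_unit: "cmod u = 1 \<Longrightarrow> Re u = 1 - (cmod (u - 1))\<^sup>2 / 2"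
proof -
  assume "cmod u = 1"
  then have "(Re u)\<^sup>2 + (Im u)\<^sup>2 = 1" using cmod_power2[of u] by simp
  moreover have "(cmod (u - 1))\<^sup>2 = (Re u - 1)\<^sup>2 + (Im u)\<^sup>2" by (simp add: cmod_power2)
  ultimately show ?thesis by (simp add: power2_eq_square algebra_simps)
qed

text \<open>The term j = 0 gives 1. The others are paired as j and q - j, and each pair is 2 cos
  (\<phi> / 2) cos (j \<phi> / q - \<phi> / 2), where both angles have modulus at most pi /
  2.\<close>

lemma sum_cos_ge_one:
  assumes "q > 0" "\<bar>\<phi>\<bar> \<le> pi"
  shows "(\<Sum>j<q. cos (real j * (\<phi> / real q))) \<ge> 1"
proof -
  let ?c = "\<lambda>j. cos (real j * (\<phi> / real q))"
  have rev: "(\<Sum>j\<in>{1..<q}. ?c (q - j)) = (\<Sum>j\<in>{1..<q}. ?c j)"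
    by (rule sum.reindex_bij_witness[of _ "\<lambda>j. q - j" "\<lambda>j. q - j"]) (auto simp del: of_nat_diff)
  have "2 * (\<Sum>j\<in>{1..<q}. ?c j) = (\<Sum>j\<in>{1..<q}. ?c j + ?c (q - j))"
    unfolding sum.distrib rev by simp
  also have "\<dots> \<ge> 0"
  proof (rule sum_nonneg)
    fix j assume j: "j \<in> {1..<q}"
    have 1: "real (q - j) = real q - real j" using j by simp
    have "?c j + ?c (q - j) = 2 * cos (\<phi> / 2) * cos (real j * (\<phi> / real q) - \<phi> / 2)"
      unfolding cos_plus_cos 1 using j
      by (intro arg_cong2[of _ _ _ _ "\<lambda>a b. 2 * cos a * cos b"]) (auto simp: field_simps)
    moreover have "cos (\<phi> / 2) \<ge> 0" using assms(2) by (intro cos_ge_zero) auto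
    moreover have "cos (real j * (\<phi> / real q) - \<phi> / 2) \<ge> 0"
    proof -
      have "\<bar>real j * (\<phi> / real q) - \<phi> / 2\<bar> = \<bar>(real j / real q - 1/2) * \<phi>\<bar>"
        using assms(1) by (simp add: field_simps)
      also have "\<bar>(real j / real q - 1/2) * \<phi>\<bar> \<le> (1/2) * pi"
        unfolding abs_mult using assms j by (intro mult_mono) (auto simp: abs_le_iff field_simps)
      finally have "\<bar>real j * (\<phi> / real q) - \<phi> / 2\<bar> \<le> pi / 2" by simp
      then show ?thesis unfolding abs_le_iff by (intro cos_ge_zero) linarith+
    qed
    ultimately show "0 \<le> ?c j + ?c (q - j)" by simp
  qed
  finally have "(\<Sum>j\<in>{1..<q}. ?c j) \<ge> 0" by simp
  moreover have "(\<Sum>j<q. ?c j) = ?c 0 + (\<Sum>j\<in>{1..<q}. ?c j)"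
    using assms(1) by (simp add: lessThan_atLeast0 sum.atLeast_Suc_lessThan del: mult_eq_0_iff)
  ultimately show ?thesis by simp
qed

text \<open>Average over all q roots w of w': orthogonality of the roots of unity removes every term
  with j > 0, so the mean of the sums is \<open>a 0\<close>, of modulus 1, and some root does at
  least as well.\<close>

lemma exists_root_large_sum:
  fixes a :: "nat \<Rightarrow> complex"
  assumes q: "q > 0" and a0: "cmod (a 0) = 1" and w': "cmod w' = 1"
  shows "\<exists>w. cmod w = 1 \<and> w ^ q = w' \<and> cmod (\<Sum>j<q. a j * cnj w ^ j) \<ge> 1"
proof -
  obtain \<phi> where \<phi>: "w' = cis \<phi>"
    using w' by (metis complex_norm_eq_1_exp cis_conv_exp)
  define w where "w b = cis ((\<phi> + 2 * pi * real b) / real q)" for b :: nat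
  have wq: "w b ^ q = w'" for b
  proof -
    have "w b ^ q = cis (real q * ((\<phi> + 2 * pi * real b) / real q))" by (simp only: w_def Complex.DeMoivre)
    also have "real q * ((\<phi> + 2 * pi * real b) / real q) = \<phi> + 2 * pi * real b" using q by simp
    also have "cis (\<phi> + 2 * pi * real b) = cis \<phi>" by (simp add: cis_mult[symmetric] cis_multiple_2pi)
    finally show ?thesis by (simp add: \<phi>)
  qed
  have orth: "(\<Sum>b<q. cnj (w b) ^ j) = (if j = 0 then of_nat q else 0)" if "j < q" for j
  proof (cases "j = 0")
    case False
    define \<zeta> where "\<zeta> = cis (- (2 * pi * real j / real q))"
    have "cnj (w b) ^ j = cis (- \<phi> / real q * real j) * \<zeta> ^ b" for b
    proof -
      have "cnj (w b) ^ j = cis (real j * (- ((\<phi> + 2 * pi * real b) / real q)))"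
        by (simp only: w_def cis_cnj Complex.DeMoivre)
      also have "real j * (- ((\<phi> + 2 * pi * real b) / real q)) =
          - \<phi> / real q * real j + real b * (- (2 * pi * real j / real q))"
        using q by (simp add: field_simps)
      finally show ?thesis by (simp only: cis_mult[symmetric] \<zeta>_def Complex.DeMoivre)
    qed
    then have "(\<Sum>b<q. cnj (w b) ^ j) = cis (- \<phi> / real q * real j) * (\<Sum>b<q. \<zeta> ^ b)"
      by (simp add: sum_distrib_left)
    also have "(\<Sum>b<q. \<zeta> ^ b) = 0"
    proof -
      have "\<zeta> \<noteq> 1"
      proof
        assume "\<zeta> = 1"
        then have "cos (2 * pi * (real j / real q)) = 1"
          by (simp add: \<zeta>_def complex_eq_iff mult.assoc)
        then obtain n :: int where "2 * pi * (real j / real q) = real_of_int n * 2 * pi"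
          unfolding cos_one_2pi_int by auto
        then have "2 * pi * (real j / real q) = 2 * pi * real_of_int n" by (simp only: mult_ac)
          then have "real j / real q = real_of_int n" unfolding mult_cancel_left by simp
        moreover have "0 < real j / real q" "real j / real q < 1" using that False by auto
        ultimately show False by simp
      qed
      moreover have "\<zeta> ^ q = 1"
      proof -
        have "\<zeta> ^ q = cis (- (2 * pi * real j))" using q by (simp add: \<zeta>_def Complex.DeMoivre)
        then show ?thesis by (simp add: complex_eq_iff) (metis cos_2npi sin_2npi mult.commute mult.assoc)
      qed
      ultimately show ?thesis by (simp add: geometric_sum)
    qed
    finally show ?thesis using False by simp
  qed simp
  have "(\<Sum>b<q. \<Sum>j<q. a j * cnj (w b) ^ j) = (\<Sum>j<q. a j * (\<Sum>b<q. cnj (w b) ^ j))"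
    by (subst sum.swap) (simp add: sum_distrib_left)
  also have "\<dots> = (\<Sum>j<q. if j = 0 then a 0 * of_nat q else 0)"
    by (intro sum.cong) (auto simp: orth)
  also have "\<dots> = a 0 * of_nat q" using q by simp
  finally have tot: "cmod (\<Sum>b<q. \<Sum>j<q. a j * cnj (w b) ^ j) = real q"
    using a0 by (simp add: norm_mult)
  have "\<exists>b<q. cmod (\<Sum>j<q. a j * cnj (w b) ^ j) \<ge> 1"
  proof (rule ccontr)
    assume "\<not> ?thesis"
    then have "(\<Sum>b<q. cmod (\<Sum>j<q. a j * cnj (w b) ^ j)) < (\<Sum>b<q. 1)"
      using q by (intro sum_strict_mono) (auto simp: not_le)
    then show False
      using norm_sum[of "\<lambda>b. \<Sum>j<q. a j * cnj (w b) ^ j" "{..<q}"] tot by simp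
  qed
  then show ?thesis using wq w_def by (metis norm_cis)
qed

text \<open>With c = cos (|\<phi>| / 2) the right side is 4 (1 - c^2) and the left side is at most 4
  (1 - c). This halving of squared chords is what keeps the distance between the frequency and f
  from accumulating over the digits.\<close>

lemma half_angle_contraction:
  assumes "q \<ge> (2::nat)" "\<bar>\<phi>\<bar> \<le> pi"
  shows "2 * (cmod (cis (\<phi> / real q) - 1))\<^sup>2 \<le> (cmod (cis \<phi> - 1))\<^sup>2"
proof -
  define c where "c = cos (\<bar>\<phi>\<bar> / 2)"
  have c: "0 \<le> c" "c \<le> 1" using assms(2) by (auto simp: c_def intro!: cos_ge_zero)
  have "\<bar>\<phi>\<bar> / real q \<le> \<bar>\<phi>\<bar> / 2" using assms(1) by (intro divide_left_mono) auto
  then have "c \<le> cos (\<bar>\<phi>\<bar> / real q)"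
    unfolding c_def using assms(2) by (intro cos_monotone_0_pi_le) auto
  also have "cos (\<bar>\<phi>\<bar> / real q) = cos (\<phi> / real q)" by (simp add: abs_if)
  finally have 1: "c \<le> cos (\<phi> / real q)" .
  have 2: "cos \<phi> = 2 * c\<^sup>2 - 1"
    using cos_double_cos[of "\<bar>\<phi>\<bar> / 2"] by (simp add: c_def)
  have "0 \<le> c * (1 - c)" using c by (intro mult_nonneg_nonneg) auto
  then have "c\<^sup>2 \<le> c" by (simp add: power2_eq_square algebra_simps)
  then show ?thesis unfolding cmod_cis_minus_one 2 using 1 by simp
qed

lemma cis_fraction_chord_le:
  assumes "j \<le> (q::nat)" "q > 0" "\<bar>\<phi>\<bar> \<le> pi"
  shows "cmod (cis (real j * (\<phi> / real q)) - 1) \<le> cmod (cis \<phi> - 1)"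
proof -
  have "real j * (\<bar>\<phi>\<bar> / real q) \<le> \<bar>\<phi>\<bar>"
    using assms mult_right_mono[of "real j" "real q" "\<bar>\<phi>\<bar>"] by (simp add: field_simps)
  then have "cos \<bar>\<phi>\<bar> \<le> cos (real j * (\<bar>\<phi>\<bar> / real q))"
    using assms by (intro cos_monotone_0_pi_le) auto
  then have "cos \<phi> \<le> cos (real j * (\<phi> / real q))" by (simp add: abs_if split: if_splits)
  then have "(cmod (cis (real j * (\<phi> / real q)) - 1))\<^sup>2 \<le> (cmod (cis \<phi> - 1))\<^sup>2"
    unfolding cmod_cis_minus_one by simp
  then show ?thesis by (rule power2_le_imp_le) simp
qed

lemma exp_minus_le:
  assumes "0 \<le> t" "t \<le> (1::real)"
  shows "exp (- t) \<le> 1 - t / 2"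
proof -
  have "0 \<le> t * (1 - t)" using assms by (intro mult_nonneg_nonneg) auto
  then have "1 \<le> (1 - t / 2) * (1 + t)" by (simp add: algebra_simps)
  also have "\<dots> \<le> (1 - t / 2) * exp t"
    using assms exp_ge_add_one_self[of t] by (intro mult_left_mono) auto
  finally show ?thesis by (simp add: exp_minus field_simps)
qed

text \<open>If the digit values a j are far from a geometric progression, averaging over all roots
  gives a bounded loss; otherwise the root nearest to z works, and the second-order
  behaviour of Re near 1 makes the loss quadratic.\<close>

lemma exists_good_root:
  fixes a :: "nat \<Rightarrow> complex" and d x :: real
  assumes q: "q \<ge> 2" and L: "L = ln (2 * real q)" and C: "C = 64 * (real q)\<^sup>2 * L"
    and a: "\<And>j. cmod (a j) = 1" and z: "cmod z = 1" and w': "cmod w' = 1"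
    and near: "\<And>j. j < q \<Longrightarrow> cmod (a j - z ^ j) \<le> d" "cmod (y - z ^ q) \<le> d"
    and x: "x = cmod (w' - y)"
  shows "\<exists>w. cmod w = 1 \<and> w ^ q = w' \<and>
    real q * exp (- C * (d\<^sup>2 + x\<^sup>2)) \<le> cmod (\<Sum>j<q. a j * cnj w ^ j) \<and>
    (cmod (w - z))\<^sup>2 \<le> 3 / 4 * x\<^sup>2 + C * d\<^sup>2"
proof -
  have L1: "1 \<le> L"
  proof -
    have "exp 1 \<le> 2 * real q" using q exp_le by linarith
    then show ?thesis unfolding L using q by (subst ln_ge_iff) auto
  qed
  have d0: "0 \<le> d" using near(2) norm_ge_zero order_trans by blast
  have q2: "1 \<le> (real q)\<^sup>2" using q by (simp add: one_le_power)
  have CL: "64 * L \<le> C" unfolding C using q2 L1 by simp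
  have eL: "exp (- L) = 1 / (2 * real q)" using q by (simp add: L exp_minus field_simps)
  show ?thesis
  \<comment> \<open>The constant C makes C d^2 >= 4 L in the first case. This pays both for a loss
    of 1 / (2 q) = exp (- L) in the sum and for the trivial bound |w - z|^2 <= 4.\<close>
  proof (cases "1 / (4 * real q) \<le> d")
    case True
    obtain w where w: "cmod w = 1" "w ^ q = w'" "1 \<le> cmod (\<Sum>j<q. a j * cnj w ^ j)"
      using exists_root_large_sum[of q a w'] q a w' by auto
    have "(1 / (4 * real q))\<^sup>2 \<le> d\<^sup>2" using True q by (intro power_mono) auto
    then have "C * (1 / (4 * real q))\<^sup>2 \<le> C * d\<^sup>2" using CL L1 by (intro mult_left_mono) auto
    moreover have "C * (1 / (4 * real q))\<^sup>2 = 4 * L" unfolding C using q by (simp add: power_divide power_mult_distrib)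
    ultimately have Cd: "4 * L \<le> C * d\<^sup>2" by simp
    have "0 \<le> C * x\<^sup>2" using CL L1 by simp
    then have "exp (- C * (d\<^sup>2 + x\<^sup>2)) \<le> exp (- L)" using Cd L1 by (simp add: distrib_left)
    then have "real q * exp (- C * (d\<^sup>2 + x\<^sup>2)) \<le> real q * (1 / (2 * real q))"
      unfolding eL by (intro mult_left_mono) auto
    then have "real q * exp (- C * (d\<^sup>2 + x\<^sup>2)) \<le> 1" using q by simp
    moreover have "(cmod (w - z))\<^sup>2 \<le> 3 / 4 * x\<^sup>2 + C * d\<^sup>2"
    proof -
      have "cmod (w - z) \<le> 2" using norm_triangle_ineq4[of w z] w z by simp
      then have "(cmod (w - z))\<^sup>2 \<le> 2\<^sup>2" by (intro power_mono) auto
      moreover have "0 \<le> 3 / 4 * x\<^sup>2" by simp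
      ultimately show ?thesis using Cd L1 unfolding power2_eq_square by linarith
    qed
    ultimately show ?thesis using w by (intro exI[of _ w]) auto
  next
    case False
    have qd: "real q * d < 1 / 4" using False q by (simp add: field_simps)
    have d8: "d < 1 / 8"
    proof -
      have "2 * d \<le> real q * d" using q d0 by (intro mult_right_mono) auto
      then show ?thesis using qd by simp
    qed
    define \<phi> where "\<phi> = Arg (w' / z ^ q)"
    have zq: "cmod (z ^ q) = 1" by (simp add: norm_power z)
    have z0: "z \<noteq> 0" using z by auto
    have \<phi>: "\<bar>\<phi>\<bar> \<le> pi" using Arg_bounded[of "w' / z ^ q"] by (auto simp: \<phi>_def)
    have "cmod (w' / z ^ q) = 1" using w' zq by (simp add: norm_divide)
    then have "w' / z ^ q = cis \<phi>"
      unfolding \<phi>_def by (metis Arg_eq_0 cis_Arg div_by_1 norm_zero of_real_1 sgn_eq zero_neq_one)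
    then have w'_eq: "w' = z ^ q * cis \<phi>" using z0 by (simp add: field_simps)
    define w where "w = z * cis (\<phi> / real q)"
    define \<psi> where "\<psi> = cmod (cis \<phi> - 1)"
    have wn: "cmod w = 1" by (simp add: w_def norm_mult z)
    have wq: "w ^ q = w'"
      unfolding w_def power_mult_distrib Complex.DeMoivre w'_eq using q by simp
    have "w' - z ^ q = z ^ q * (cis \<phi> - 1)" by (simp add: w'_eq algebra_simps)
    then have "\<psi> = cmod (w' - z ^ q)" by (simp add: norm_mult zq \<psi>_def)
    also have "\<dots> \<le> cmod (w' - y) + cmod (y - z ^ q)"
      using norm_triangle_ineq[of "w' - y" "y - z ^ q"] by simp
    finally have \<psi>x: "\<psi> \<le> x + d" using near(2) x by simp
    have \<psi>0: "0 \<le> \<psi>" "0 \<le> x" by (simp_all add: \<psi>_def x)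
    \<comment> \<open>The weights are chosen so that the halving of the squared chord leaves 3 / 4 <
      1 in front of x^2.\<close>
    have sq_le: "(x + d)\<^sup>2 \<le> 3 / 2 * x\<^sup>2 + 3 * d\<^sup>2"
    proof -
      have "0 \<le> (x - 2 * d)\<^sup>2" by simp
      then show ?thesis by (simp add: power2_eq_square algebra_simps)
    qed
    have "(cmod (w - z))\<^sup>2 \<le> 3 / 4 * x\<^sup>2 + C * d\<^sup>2"
    proof -
      have "w - z = z * (cis (\<phi> / real q) - 1)" by (simp add: w_def algebra_simps)
      then have "2 * (cmod (w - z))\<^sup>2 = 2 * (cmod (cis (\<phi> / real q) - 1))\<^sup>2" by (simp add: norm_mult z)
      also have "\<dots> \<le> \<psi>\<^sup>2" unfolding \<psi>_def by (rule half_angle_contraction[OF q \<phi>])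
      also have "\<dots> \<le> (x + d)\<^sup>2" using \<psi>x \<psi>0 by (intro power_mono) auto
      finally have "(cmod (w - z))\<^sup>2 \<le> 3 / 4 * x\<^sup>2 + 3 / 2 * d\<^sup>2" using sq_le by simp
      moreover have "3 / 2 * d\<^sup>2 \<le> C * d\<^sup>2" using CL L1 by (intro mult_right_mono) auto
      ultimately show ?thesis by simp
    qed
    moreover have "real q * exp (- C * (d\<^sup>2 + x\<^sup>2)) \<le> cmod (\<Sum>j<q. a j * cnj w ^ j)"
    proof (cases "d + \<psi> \<le> 1")
      case True
      define t where "t = (d + \<psi>)\<^sup>2"
      have Re_ge: "1 - t / 2 \<le> Re (a j * cnj w ^ j)" if "j < q" for j
      proof -
        have wwj: "w ^ j * cnj w ^ j = 1"
          unfolding power_mult_distrib[symmetric] complex_norm_square[symmetric] by (simp add: wn)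
        have "a j * cnj w ^ j - 1 = (a j - w ^ j) * cnj w ^ j" using wwj by (simp add: left_diff_distrib)
        then have "cmod (a j * cnj w ^ j - 1) = cmod (a j - w ^ j)"
          by (simp add: norm_mult norm_power wn)
        also have "\<dots> \<le> cmod (a j - z ^ j) + cmod (w ^ j - z ^ j)"
          using norm_triangle_ineq4[of "a j - z ^ j" "w ^ j - z ^ j"] by simp
        also have "w ^ j - z ^ j = z ^ j * (cis (real j * (\<phi> / real q)) - 1)"
          unfolding w_def power_mult_distrib Complex.DeMoivre by (simp add: right_diff_distrib)
        also have "cmod \<dots> = cmod (cis (real j * (\<phi> / real q)) - 1)" by (simp add: norm_mult norm_power z)
        also have "\<dots> \<le> \<psi>" unfolding \<psi>_def using that q by (intro cis_fraction_chord_le \<phi>) auto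
        finally have "cmod (a j * cnj w ^ j - 1) \<le> d + \<psi>" using near(1)[OF that] by linarith
        then have "(cmod (a j * cnj w ^ j - 1))\<^sup>2 \<le> t" unfolding t_def by (intro power_mono) auto
        then show ?thesis
          using Re_unit[of "a j * cnj w ^ j"] by (simp add: norm_mult norm_power wn a)
      qed
      have t: "0 \<le> t" "t \<le> 1" using True d0 \<psi>0 by (auto simp: t_def power_le_one)
      have "t \<le> (x + 2 * d)\<^sup>2" unfolding t_def using \<psi>x \<psi>0 d0 by (intro power_mono) auto
      also have "\<dots> \<le> 2 * x\<^sup>2 + 8 * d\<^sup>2"
      proof -
        have "0 \<le> (x - 2 * d)\<^sup>2" by simp
        then show ?thesis by (simp add: power2_eq_square algebra_simps)
      qed
      also have "\<dots> \<le> C * x\<^sup>2 + C * d\<^sup>2" using CL L1 by (intro add_mono mult_right_mono) auto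
      finally have "exp (- C * (d\<^sup>2 + x\<^sup>2)) \<le> exp (- t)" by (simp add: distrib_left)
      also have "\<dots> \<le> 1 - t / 2" by (rule exp_minus_le[OF t])
      finally have "real q * exp (- C * (d\<^sup>2 + x\<^sup>2)) \<le> real q * (1 - t / 2)"
        by (intro mult_left_mono) auto
      also have "\<dots> = (\<Sum>j<q. 1 - t / 2)" by simp
      also have "\<dots> \<le> (\<Sum>j<q. Re (a j * cnj w ^ j))" by (intro sum_mono Re_ge) auto
      also have "\<dots> = Re (\<Sum>j<q. a j * cnj w ^ j)" by simp
      also have "\<dots> \<le> cmod (\<Sum>j<q. a j * cnj w ^ j)" by (rule complex_Re_le_cmod)
      finally show ?thesis .
    next
      \<comment> \<open>Here x >= 1 / 2, so C x^2 >= L allows a loss by a constant factor. It then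
        suffices that the sum is at least 1 / 2, and the cosine sum minus q d < 1 / 4 provides this
        without any closeness of w to z.\<close>
      case far: False
      have "1 / 2 \<le> x" using far \<psi>x d8 by linarith
      then have "(1 / 2)\<^sup>2 \<le> x\<^sup>2" by (intro power_mono) auto
      then have "C * (1 / 4) \<le> C * x\<^sup>2" using CL L1 by (intro mult_left_mono) (auto simp: power_divide)
      moreover have "0 \<le> C * d\<^sup>2" using CL L1 by simp
      ultimately have "L \<le> C * (d\<^sup>2 + x\<^sup>2)" unfolding distrib_left using CL L1 by linarith
      then have "exp (- C * (d\<^sup>2 + x\<^sup>2)) \<le> exp (- L)" by simp
      then have "real q * exp (- C * (d\<^sup>2 + x\<^sup>2)) \<le> real q * (1 / (2 * real q))"
        unfolding eL by (intro mult_left_mono) auto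
      then have half: "real q * exp (- C * (d\<^sup>2 + x\<^sup>2)) \<le> 1 / 2" using q by simp
      have Re_ge: "cos (real j * (\<phi> / real q)) - d \<le> Re (a j * cnj w ^ j)" if "j < q" for j
      proof -
        have "z ^ j * cnj w ^ j = (z * cnj z) ^ j * cnj (cis (\<phi> / real q)) ^ j"
          by (simp add: w_def power_mult_distrib)
        also have "z * cnj z = 1" using complex_norm_square[of z] z by simp
        finally have "z ^ j * cnj w ^ j = cis (- (real j * (\<phi> / real q)))"
          by (simp add: cis_cnj Complex.DeMoivre)
        then have "Re (z ^ j * cnj w ^ j) = cos (real j * (\<phi> / real q))" by simp
        moreover have "Re (a j * cnj w ^ j) = Re (z ^ j * cnj w ^ j) + Re ((a j - z ^ j) * cnj w ^ j)"
          by (simp only: plus_complex.simps[symmetric] distrib_right[symmetric]) simp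
        moreover have "- d \<le> Re ((a j - z ^ j) * cnj w ^ j)"
        proof -
          have "\<bar>Re ((a j - z ^ j) * cnj w ^ j)\<bar> \<le> cmod ((a j - z ^ j) * cnj w ^ j)" by (rule abs_Re_le_cmod)
          also have "\<dots> \<le> d" using near(1)[OF that] by (simp add: norm_mult norm_power wn)
          finally show ?thesis by linarith
        qed
        ultimately show ?thesis by linarith
      qed
      have "1 / 2 \<le> (\<Sum>j<q. cos (real j * (\<phi> / real q))) - real q * d"
        using sum_cos_ge_one[of q \<phi>] q \<phi> qd by simp
      also have "\<dots> = (\<Sum>j<q. cos (real j * (\<phi> / real q)) - d)" by (simp add: sum_subtractf)
      also have "\<dots> \<le> (\<Sum>j<q. Re (a j * cnj w ^ j))" by (intro sum_mono Re_ge) auto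
      also have "\<dots> = Re (\<Sum>j<q. a j * cnj w ^ j)" by simp
      also have "\<dots> \<le> cmod (\<Sum>j<q. a j * cnj w ^ j)" by (rule complex_Re_le_cmod)
      finally show ?thesis using half by linarith
    qed
    ultimately show ?thesis using wn wq by blast
  qed
qed

section \<open>The frequency built digit by digit\<close>

lemma near_geometric_progression:
  assumes qm: "q_multiplicative q f" and "j \<le> q"
  shows "cmod (f j - f 1 ^ j) \<le> total_defect q f 0"
proof -
  note unit = q_multiplicative_unit[OF qm]
  have f0: "f 0 = 1"
  proof -
    have "f (0 + q ^ 0 * 0) = f 0 * f (q ^ 0 * 0)" by (rule q_multiplicative_add[OF qm]) simp
    moreover have "f 0 \<noteq> 0" using unit[of 0] by auto
    ultimately show ?thesis by simp
  qed
  \<comment> \<open>Multiplication by the unimodular \<open>f 1\<close> preserves the error so far,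
    so each step adds one defect. The endpoint j = q is included because it compares f q, the target
    for the next frequency w', with \<open>f 1 ^ q\<close>.\<close>
  have "cmod (f j - f 1 ^ j) \<le> (\<Sum>i<j. digit_defect q f 0 i)"
  proof (induction j)
    case 0
    then show ?case using f0 by simp
  next
    case (Suc j)
    have "f (Suc j) - f 1 ^ Suc j = (f (j + 1) - f j * f 1) + (f j - f 1 ^ j) * f 1"
      by (simp add: algebra_simps)
    then have "cmod (f (Suc j) - f 1 ^ Suc j) \<le> cmod (f (j + 1) - f j * f 1) + cmod ((f j - f 1 ^ j) * f 1)"
      by (simp only: norm_triangle_ineq)
    also have "\<dots> \<le> digit_defect q f 0 j + (\<Sum>i<j. digit_defect q f 0 i)"
      using Suc.IH unit[of 1] by (simp add: digit_defect_def norm_mult)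
    finally show ?case by simp
  qed
  also have "\<dots> \<le> total_defect q f 0"
    unfolding total_defect_def using assms(2)
    by (intro sum_mono2) (auto simp: digit_defect_nonneg)
  finally show ?thesis .
qed

lemma sum_digits_split:
  fixes f :: "nat \<Rightarrow> complex"
  assumes qm: "q_multiplicative q f"
  shows "(\<Sum>n<q ^ Suc T. f n * u ^ n) = (\<Sum>j<q. f j * u ^ j) * (\<Sum>m<q ^ T. f (q * m) * (u ^ q) ^ m)"
proof -
  have "(\<Sum>n<q ^ Suc T. f n * u ^ n) = (\<Sum>n<q ^ T * q. f n * u ^ n)" by (simp add: mult.commute)
  also have "\<dots> = (\<Sum>m<q ^ T. \<Sum>n\<in>{m * q..<m * q + q}. f n * u ^ n)"
    by (rule sum.nat_group[symmetric])
  also have "\<dots> = (\<Sum>m<q ^ T. \<Sum>j<q. f (j + m * q) * u ^ (j + m * q))"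
  proof (rule sum.cong[OF refl])
    fix m
    show "(\<Sum>n\<in>{m * q..<m * q + q}. f n * u ^ n) = (\<Sum>j<q. f (j + m * q) * u ^ (j + m * q))"
      using sum.shift_bounds_nat_ivl[of "\<lambda>n. f n * u ^ n" 0 "m * q" q]
      by (simp add: lessThan_atLeast0 add.commute)
  qed
  also have "\<dots> = (\<Sum>m<q ^ T. \<Sum>j<q. (f j * u ^ j) * (f (q * m) * (u ^ q) ^ m))"
  proof (intro sum.cong refl)
    fix m j assume "j \<in> {..<q}"
    then have "f (j + q ^ 1 * m) = f j * f (q ^ 1 * m)" by (intro q_multiplicative_add[OF qm]) simp
    moreover have "u ^ (j + m * q) = u ^ j * (u ^ q) ^ m"
      by (simp add: power_add power_mult[symmetric] mult.commute)
    ultimately show "f (j + m * q) * u ^ (j + m * q) = (f j * u ^ j) * (f (q * m) * (u ^ q) ^ m)"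
      by (simp add: mult.commute mult.left_commute)
  qed
  also have "\<dots> = (\<Sum>j<q. f j * u ^ j) * (\<Sum>m<q ^ T. f (q * m) * (u ^ q) ^ m)"
    by (subst sum.swap) (simp add: sum_product)
  finally show ?thesis .
qed

text \<open>The term 4 C (4 - |w - f 1|^2) is a potential. A digit costs C (d^2 + x^2), where x is
  the distance of w' to f q, while the new squared distance is at most 3/4 x^2 + C d^2. With weight
  4 C the drop of x^2 / 4 pays exactly for C x^2, and the remainder 4 C^2 d^2 explains the rate C +
  4 C^2. The constant 4 keeps the potential nonnegative, as distances on the circle are at most
  2.\<close>

lemma exists_linear_correlation:
  assumes q: "q \<ge> 2" and L: "L = ln (2 * real q)" and C: "C = 64 * (real q)\<^sup>2 * L"
    and qm: "q_multiplicative q f"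
  shows "\<exists>w. cmod w = 1 \<and>
    real (q ^ T) * exp (- (C + 4 * C\<^sup>2) * (\<Sum>i<T. (total_defect q f i)\<^sup>2) - 4 * C * (4 - (cmod (w - f 1))\<^sup>2))
    \<le> cmod (\<Sum>n<q ^ T. f n * cnj w ^ n)"
  using qm
proof (induction T arbitrary: f)
  case 0
  note unit = q_multiplicative_unit[OF 0]
  have "C \<ge> 0" unfolding C L using q by simp
  then show ?case using unit by (intro exI[of _ "f 1"]) simp
next
  case (Suc T)
  note unit = q_multiplicative_unit[OF Suc.prems]
  have C0: "C \<ge> 0" unfolding C L using q by simp
  let ?g = "\<lambda>n. f (q ^ 1 * n)"
  have g: "q_multiplicative q ?g" using Suc.prems q by (intro q_multiplicative_scale) auto
  have g_def: "total_defect q ?g i = total_defect q f (Suc i)" for i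
    using total_defect_scale[of q f 1 i] by simp
  define \<Sigma> where "\<Sigma> = (\<Sum>i<T. (total_defect q f (Suc i))\<^sup>2)"
  define d where "d = total_defect q f 0"
  obtain w' where w': "cmod w' = 1" and le: "real (q ^ T) * exp (- (C + 4 * C\<^sup>2) * \<Sigma>
      - 4 * C * (4 - (cmod (w' - f q))\<^sup>2)) \<le> cmod (\<Sum>n<q ^ T. f (q * n) * cnj w' ^ n)"
    using Suc.IH[OF g] unfolding g_def \<Sigma>_def by auto
  define x where "x = cmod (w' - f q)"
  have near: "cmod (f j - f 1 ^ j) \<le> d" if "j \<le> q" for j
    unfolding d_def by (rule near_geometric_progression[OF Suc.prems that])
  obtain w where w: "cmod w = 1" "w ^ q = w'"
    and fac: "real q * exp (- C * (d\<^sup>2 + x\<^sup>2)) \<le> cmod (\<Sum>j<q. f j * cnj w ^ j)"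
    and contr: "(cmod (w - f 1))\<^sup>2 \<le> 3 / 4 * x\<^sup>2 + C * d\<^sup>2"
    using exists_good_root[OF q L C, of f "f 1" w' d "f q" x] unit w' near x_def by auto
  define E where "E = (cmod (w - f 1))\<^sup>2"
  have "4 * C * E \<le> 4 * C * (3 / 4 * x\<^sup>2 + C * d\<^sup>2)"
    using contr C0 unfolding E_def by (intro mult_left_mono) auto
  then have expo: "- (C + 4 * C\<^sup>2) * (d\<^sup>2 + \<Sigma>) - 4 * C * (4 - E) \<le>
      - C * (d\<^sup>2 + x\<^sup>2) + (- (C + 4 * C\<^sup>2) * \<Sigma> - 4 * C * (4 - x\<^sup>2))"
    by (simp add: power2_eq_square algebra_simps)
  have "(\<Sum>i<Suc T. (total_defect q f i)\<^sup>2) = d\<^sup>2 + \<Sigma>"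
    unfolding d_def \<Sigma>_def by (rule sum.lessThan_Suc_shift)
  then have "real (q ^ Suc T) * exp (- (C + 4 * C\<^sup>2) * (\<Sum>i<Suc T. (total_defect q f i)\<^sup>2) - 4 * C * (4 - E))
     \<le> real (q ^ Suc T) * exp (- C * (d\<^sup>2 + x\<^sup>2) + (- (C + 4 * C\<^sup>2) * \<Sigma> - 4 * C * (4 - x\<^sup>2)))"
    using expo by (intro mult_left_mono) auto
  also have "\<dots> = (real q * exp (- C * (d\<^sup>2 + x\<^sup>2))) *
      (real (q ^ T) * exp (- (C + 4 * C\<^sup>2) * \<Sigma> - 4 * C * (4 - x\<^sup>2)))"
    by (simp only: exp_add) simp
  also have "\<dots> \<le> cmod (\<Sum>j<q. f j * cnj w ^ j) * cmod (\<Sum>n<q ^ T. f (q * n) * cnj w' ^ n)"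
    using fac le unfolding x_def by (intro mult_mono) auto
  also have "\<dots> = cmod (\<Sum>n<q ^ Suc T. f n * cnj w ^ n)"
    using sum_digits_split[OF Suc.prems, of "cnj w" T] w(2) by (simp add: norm_mult flip: complex_cnj_power)
  finally show ?case using w(1) unfolding E_def by blast
qed

section \<open>The second Gowers norm and linear correlations\<close>

definition interval_ext :: "nat \<Rightarrow> (nat \<Rightarrow> complex) \<Rightarrow> int \<Rightarrow> complex" where
  "interval_ext N f x = (if 0 \<le> x \<and> x < int N then f (nat x) else 0)"

definition autocorr :: "nat \<Rightarrow> (int \<Rightarrow> complex) \<Rightarrow> int \<Rightarrow> complex" where
  "autocorr N F a = (\<Sum>x\<in>{0..<int N}. F (x + a) * cnj (F x))"

lemma prod_Pow_two: "(\<Prod>S\<in>Pow {1..2::nat}. h S) = h {} * h {1} * h {2} * h {1, 2}"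
proof -
  have eq: "{1..2::nat} = insert 1 (insert 2 {})" by auto
  have "(\<Prod>S\<in>Pow {1..2::nat}. h S) = (\<Prod>S\<in>Pow (insert 2 {}). h S * h (insert 1 S))"
    unfolding eq by (rule prod_Pow_insert) auto
  also have "\<dots> = (\<Prod>S\<in>Pow {}. (h S * h (insert 1 S)) * (h (insert 2 S) * h (insert 1 (insert 2 S))))"
    by (rule prod_Pow_insert) auto
  finally show ?thesis by (simp add: mult_ac)
qed

lemma all_subsets_two: "(\<forall>S. S \<subseteq> {1..2::nat} \<longrightarrow> P S) \<longleftrightarrow> P {} \<and> P {1} \<and> P {2} \<and> P {1, 2}"
proof -
  have "{1..2::nat} = {1, 2}" by auto
  then have "Pow {1..2::nat} = {{}, {1}, {2}, {1, 2}}" by (auto simp: Pow_insert)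
  moreover have "(\<forall>S. S \<subseteq> {1..2::nat} \<longrightarrow> P S) \<longleftrightarrow> (\<forall>S\<in>Pow {1..2::nat}. P S)" by auto
  ultimately show ?thesis by simp
qed

text \<open>A two-dimensional cube is a pair of parallel edges of the same length a, starting at y
  and x. For fixed a the two edges are independent, so the sum over cubes factors into an
  autocorrelation and its conjugate.\<close>

lemma sum_Pi_set_two_eq:
  "(\<Sum>v\<in>Pi_set 2 N. \<Prod>S\<in>Pow {1..2}. (if odd (card S) then cnj else id) (f (nat (cube_pt v S)))) =
    (\<Sum>a\<in>{- int N..int N}. autocorr N (interval_ext N f) a * cnj (autocorr N (interval_ext N f) a))"
proof -
  let ?F = "interval_ext N f"
  define tm where "tm = (\<lambda>(a, x, y). (?F (x + a) * cnj (?F x)) * (cnj (?F (y + a)) * ?F y))"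
  define dom where "dom = {- int N..int N} \<times> {0..<int N} \<times> {0..<int N}"
  define ok where "ok = {(a, x, y). (a, x, y) \<in> dom \<and> x + a \<in> {0..<int N} \<and> y + a \<in> {0..<int N}}"
  have "(\<Sum>a\<in>{- int N..int N}. autocorr N ?F a * cnj (autocorr N ?F a)) =
      (\<Sum>a\<in>{- int N..int N}. \<Sum>x\<in>{0..<int N}. \<Sum>y\<in>{0..<int N}. tm (a, x, y))"
    by (simp add: autocorr_def tm_def sum_product)
  also have "\<dots> = sum tm dom"
    unfolding dom_def by (simp add: sum.cartesian_product)
  also have "\<dots> = sum tm ok"
  proof (rule sum.mono_neutral_right)
    show "finite dom" by (simp add: dom_def)
    show "ok \<subseteq> dom" by (auto simp: ok_def)
    show "\<forall>i\<in>dom - ok. tm i = 0" by (auto simp: ok_def tm_def interval_ext_def split: if_splits)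
  qed
  also have "\<dots> = (\<Sum>v\<in>Pi_set 2 N. \<Prod>S\<in>Pow {1..2}. (if odd (card S) then cnj else id) (f (nat (cube_pt v S))))"
  proof (rule sum.reindex_bij_witness[of _ "\<lambda>v. (v ! 1, v ! 0 + v ! 2, v ! 0)" "\<lambda>(a, x, y). [y, a, x - y]"])
    fix v assume v: "v \<in> Pi_set 2 N"
    then have len: "length v = 3" by (simp add: Pi_set_def)
    then obtain y a b where vv: "v = [y, a, b]"
      by (auto simp: eval_nat_numeral length_Suc_conv)
    have pts: "0 \<le> y" "y < int N" "0 \<le> y + a" "y + a < int N" "0 \<le> y + b" "y + b < int N"
      "0 \<le> y + (a + b)" "y + (a + b) < int N"
      using v unfolding Pi_set_def mem_Collect_eq all_subsets_two by (simp_all add: vv cube_pt_def)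
    show "(case (v ! 1, v ! 0 + v ! 2, v ! 0) of (a, x, y) \<Rightarrow> [y, a, x - y]) = v" by (simp add: vv)
    show "(v ! 1, v ! 0 + v ! 2, v ! 0) \<in> ok"
      using pts by (simp add: ok_def dom_def vv)
  next
    fix p assume p: "p \<in> ok"
    obtain a x y where pp: "p = (a, x, y)" by (cases p) auto
    have r: "0 \<le> x" "x < int N" "0 \<le> y" "y < int N" "0 \<le> x + a" "x + a < int N" "0 \<le> y + a" "y + a < int N"
      using p by (simp_all add: pp ok_def dom_def)
    show "((case p of (a, x, y) \<Rightarrow> [y, a, x - y]) ! 1, (case p of (a, x, y) \<Rightarrow> [y, a, x - y]) ! 0 +
        (case p of (a, x, y) \<Rightarrow> [y, a, x - y]) ! 2, (case p of (a, x, y) \<Rightarrow> [y, a, x - y]) ! 0) = p"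
      by (simp add: pp)
    show "(case p of (a, x, y) \<Rightarrow> [y, a, x - y]) \<in> Pi_set 2 N"
      unfolding Pi_set_def mem_Collect_eq all_subsets_two using r by (simp add: pp cube_pt_def algebra_simps)
    show "(\<Prod>S\<in>Pow {1..2}. (if odd (card S) then cnj else id)
        (f (nat (cube_pt (case p of (a, x, y) \<Rightarrow> [y, a, x - y]) S)))) = tm p"
      unfolding prod_Pow_two using r
      by (simp add: pp cube_pt_def tm_def interval_ext_def algebra_simps)
  qed
  finally show ?thesis by simp
qed

lemma sum_Pi_set_two_eq_norms:
  "(\<Sum>v\<in>Pi_set 2 N. \<Prod>S\<in>Pow {1..2}. (if odd (card S) then cnj else id) (f (nat (cube_pt v S)))) =
    of_real (\<Sum>a\<in>{- int N..int N}. (cmod (autocorr N (interval_ext N f) a))\<^sup>2)"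
  unfolding sum_Pi_set_two_eq by (simp only: of_real_sum complex_norm_square)

text \<open>Expanding the squares and summing over the window position h gives autocorrelations at j
  - k. Cauchy-Schwarz is then applied in j and in k; for fixed j the differences j - k are distinct,
  so the inner sum of squares is at most the full one.\<close>

lemma sum_sq_window_le:
  fixes G :: "int \<Rightarrow> complex"
  assumes supp: "\<And>x. x \<notin> {0..<int N} \<Longrightarrow> G x = 0" and M: "M \<le> N"
  shows "((\<Sum>h\<in>{- int M..int N}. (cmod (\<Sum>j<M. G (h + int j)))\<^sup>2))\<^sup>2 \<le>
    real M ^ 3 * (\<Sum>a\<in>{- int N..int N}. (cmod (autocorr N G a))\<^sup>2)"
proof -
  let ?S = "\<Sum>a\<in>{- int N..int N}. (cmod (autocorr N G a))\<^sup>2"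
  let ?R = "\<lambda>j k. cmod (autocorr N G (int j - int k))"
  \<comment> \<open>The range from -M to N contains every h for which the window meets the support
    of G, so no term of the autocorrelation is cut off.\<close>
  have corr: "(\<Sum>h\<in>{- int M..int N}. G (h + int j) * cnj (G (h + int k))) = autocorr N G (int j - int k)"
    if jk: "j < M" "k < M" for j k
  proof -
    have "(\<Sum>h\<in>{- int M..int N}. G (h + int j) * cnj (G (h + int k))) =
        (\<Sum>x\<in>{- int M + int k..int N + int k}. G (x + (int j - int k)) * cnj (G x))"
      by (rule sum.reindex_bij_witness[of _ "\<lambda>x. x - int k" "\<lambda>h. h + int k"]) (auto simp: algebra_simps)
    also have "\<dots> = autocorr N G (int j - int k)"
      unfolding autocorr_def using jk M by (intro sum.mono_neutral_right) (auto simp: supp)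
    finally show ?thesis .
  qed
  have "complex_of_real (\<Sum>h\<in>{- int M..int N}. (cmod (\<Sum>j<M. G (h + int j)))\<^sup>2) =
      (\<Sum>h\<in>{- int M..int N}. \<Sum>j<M. \<Sum>k<M. G (h + int j) * cnj (G (h + int k)))"
    by (simp only: of_real_sum complex_norm_square cnj_sum sum_product)
  also have "\<dots> = (\<Sum>j<M. \<Sum>h\<in>{- int M..int N}. \<Sum>k<M. G (h + int j) * cnj (G (h + int k)))"
    by (rule sum.swap)
  also have "\<dots> = (\<Sum>j<M. \<Sum>k<M. \<Sum>h\<in>{- int M..int N}. G (h + int j) * cnj (G (h + int k)))"
    by (intro sum.cong refl sum.swap)
  also have "\<dots> = (\<Sum>j<M. \<Sum>k<M. autocorr N G (int j - int k))"
    by (intro sum.cong refl corr) auto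
  finally have eq: "complex_of_real (\<Sum>h\<in>{- int M..int N}. (cmod (\<Sum>j<M. G (h + int j)))\<^sup>2) =
      (\<Sum>j<M. \<Sum>k<M. autocorr N G (int j - int k))" .
  have nn: "0 \<le> (\<Sum>h\<in>{- int M..int N}. (cmod (\<Sum>j<M. G (h + int j)))\<^sup>2)" by (intro sum_nonneg) auto
  have "(\<Sum>h\<in>{- int M..int N}. (cmod (\<Sum>j<M. G (h + int j)))\<^sup>2) =
      cmod (\<Sum>j<M. \<Sum>k<M. autocorr N G (int j - int k))"
    unfolding eq[symmetric] norm_of_real using nn by simp
  also have "\<dots> \<le> (\<Sum>j<M. \<Sum>k<M. ?R j k)"
    by (rule order_trans[OF norm_sum]) (intro sum_mono norm_sum)
  finally have le: "(\<Sum>h\<in>{- int M..int N}. (cmod (\<Sum>j<M. G (h + int j)))\<^sup>2) \<le> (\<Sum>j<M. \<Sum>k<M. ?R j k)" .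
  have inner: "(\<Sum>k<M. (?R j k)\<^sup>2) \<le> ?S" if "j < M" for j
  proof -
    have "(\<Sum>k<M. (?R j k)\<^sup>2) = (\<Sum>a\<in>(\<lambda>k. int j - int k) ` {..<M}. (cmod (autocorr N G a))\<^sup>2)"
      by (subst sum.reindex) (auto simp: inj_on_def)
    also have "\<dots> \<le> ?S" using that M by (intro sum_mono2) auto
    finally show ?thesis .
  qed
  have "((\<Sum>h\<in>{- int M..int N}. (cmod (\<Sum>j<M. G (h + int j)))\<^sup>2))\<^sup>2 \<le> (\<Sum>j<M. \<Sum>k<M. ?R j k)\<^sup>2"
    using le nn by (intro power_mono) auto
  also have "\<dots> \<le> (\<Sum>j<M. (\<Sum>k<M. ?R j k)\<^sup>2) * real (card {..<M})"
    by (rule sum_squared_le_sum_of_squares)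
  also have "\<dots> \<le> (\<Sum>j<M. real M * ?S) * real M"
  proof -
    have "(\<Sum>k<M. ?R j k)\<^sup>2 \<le> real M * ?S" if "j < M" for j
    proof -
      have "(\<Sum>k<M. ?R j k)\<^sup>2 \<le> (\<Sum>k<M. (?R j k)\<^sup>2) * real (card {..<M})"
        by (rule sum_squared_le_sum_of_squares)
      also have "\<dots> \<le> ?S * real (card {..<M})" by (intro mult_right_mono inner that) auto
      finally show ?thesis by (simp add: mult.commute)
    qed
    then have "(\<Sum>j<M. (\<Sum>k<M. ?R j k)\<^sup>2) \<le> (\<Sum>j<M. real M * ?S)" by (intro sum_mono) auto
    then show ?thesis unfolding card_lessThan by (rule mult_right_mono) simp
  qed
  also have "\<dots> = real M ^ 3 * ?S" by (simp add: power3_eq_cube)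
  finally show ?thesis .
qed

text \<open>Windows of length M starting near 0 have almost the same sum, so a large sum over [0, M) forces
  many large window sums; this loses only a power of the correlation and avoids cutting [0, N) sharply.\<close>

lemma gowers_two_ge_correlation:
  fixes f :: "nat \<Rightarrow> complex"
  assumes unit: "\<And>n. cmod (f n) = 1" and w: "cmod w = 1" and M: "1 \<le> M" "M \<le> N"
    and \<beta>: "\<beta> * real M \<le> cmod (\<Sum>n<M. f n * cnj w ^ n)" "0 \<le> \<beta>" "\<beta> \<le> 1"
  shows "\<beta> ^ 6 * real M ^ 3 / 256 \<le>
    (\<Sum>a\<in>{- int N..int N}. (cmod (autocorr N (interval_ext N f) a))\<^sup>2)"
proof -
  let ?F = "interval_ext N f"
  \<comment> \<open>Modulation by w turns the correlation into a plain window sum and multiplies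
    each autocorrelation by a unimodular number only. Windows may start at negative integers, hence
    \<open>powi\<close>.\<close>
  define G where "G x = ?F x * w powi (- x)" for x
  have w0: "w \<noteq> 0" using w by auto
  have cw: "cmod (w powi x) = 1" for x by (simp add: norm_power_int w)
  have supp: "G x = 0" if "x \<notin> {0..<int N}" for x using that by (auto simp: G_def interval_ext_def)
  have G1: "cmod (G x) \<le> 1" for x by (simp add: G_def norm_mult cw interval_ext_def unit)
  have corrG: "cmod (autocorr N G a) = cmod (autocorr N ?F a)" for a
  proof -
    have "G (x + a) * cnj (G x) = w powi (- a) * (?F (x + a) * cnj (?F x))" for x
    proof -
      have "w powi (- x) * cnj (w powi (- x)) = 1"
        unfolding complex_norm_square[symmetric] by (simp add: cw)
      moreover have "w powi (- (x + a)) = w powi (- a) * w powi (- x)"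
        using power_int_add[of w "- a" "- x"] w0 by (simp add: add.commute)
      ultimately show ?thesis by (simp add: G_def mult_ac)
    qed
    then have "autocorr N G a = w powi (- a) * autocorr N ?F a"
      by (simp add: autocorr_def sum_distrib_left)
    then show ?thesis by (simp add: norm_mult cw)
  qed
  define B where "B h = (\<Sum>j<M. G (h + int j))" for h
  define S where "S = (\<Sum>a\<in>{- int N..int N}. (cmod (autocorr N ?F a))\<^sup>2)"
  have upper: "(\<Sum>h\<in>{- int M..int N}. (cmod (B h))\<^sup>2)\<^sup>2 \<le> real M ^ 3 * S"
    using sum_sq_window_le[of N G M, OF supp M(2)] unfolding B_def S_def corrG by simp
  have "B 0 = (\<Sum>n<M. f n * cnj w ^ n)"
    unfolding B_def
  proof (intro sum.cong refl)
    fix n assume "n \<in> {..<M}"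
    moreover have "w powi (- int n) = cnj w ^ n"
    proof -
      have "inverse w = cnj w"
        using complex_norm_square[of w] w by (intro inverse_unique) simp
      then show ?thesis by (simp add: power_int_minus power_inverse[symmetric])
    qed
    ultimately show "G (0 + int n) = f n * cnj w ^ n" using M by (simp add: G_def interval_ext_def)
  qed
  then have B0: "\<beta> * real M \<le> cmod (B 0)" using \<beta>(1) by simp
  have Bstep: "cmod (B (int h)) \<ge> cmod (B 0) - 2 * real h" for h
  proof (induction h)
    case (Suc h)
    have "B (int h) + G (int h + int M) = (\<Sum>j<Suc M. G (int h + int j))"
      unfolding B_def by simp
    also have "\<dots> = G (int h) + B (int (Suc h))"
      unfolding B_def sum.lessThan_Suc_shift by (simp add: algebra_simps)
    finally have "B (int h) = B (int (Suc h)) + (G (int h) - G (int h + int M))" by (simp add: algebra_simps)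
    then have "cmod (B (int h)) \<le> cmod (B (int (Suc h))) + cmod (G (int h) - G (int h + int M))"
      by (metis norm_triangle_ineq)
    also have "cmod (G (int h) - G (int h + int M)) \<le> 2"
      using norm_triangle_ineq4[of "G (int h)" "G (int h + int M)"] G1[of "int h"] G1[of "int h + int M"] by linarith
    finally show ?case using Suc.IH by simp
  qed simp
  \<comment> \<open>A shift by h changes the window sum by at most 2 h, so for h <= \<beta> M / 4 at
    least half of \<beta> M remains. The 256 in the claim is the square of 4 * 2^2.\<close>
  define m where "m = nat \<lceil>\<beta> * real M / 4\<rceil>"
  have \<beta>M: "0 \<le> \<beta> * real M" "\<beta> * real M \<le> real M" using \<beta> by (auto simp: mult_left_le_one_le)
  have m_ge: "\<beta> * real M / 4 \<le> real m" unfolding m_def using real_nat_ceiling_ge by simp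
  have m_lt: "real h \<le> \<beta> * real M / 4" if "h < m" for h
    using that unfolding m_def by linarith
  have lower: "(\<beta> * real M / 4) * (\<beta> * real M / 2)\<^sup>2 \<le> (\<Sum>h\<in>{- int M..int N}. (cmod (B h))\<^sup>2)"
  proof -
    have "(\<beta> * real M / 4) * (\<beta> * real M / 2)\<^sup>2 \<le> (\<Sum>h<m. (\<beta> * real M / 2)\<^sup>2)"
      using mult_right_mono[OF m_ge, of "(\<beta> * real M / 2)\<^sup>2"] by simp
    also have "\<dots> \<le> (\<Sum>h<m. (cmod (B (int h)))\<^sup>2)"
    proof (intro sum_mono power_mono)
      fix h assume "h \<in> {..<m}"
      then show "\<beta> * real M / 2 \<le> cmod (B (int h))" using m_lt[of h] Bstep[of h] B0 by simp
    qed (use \<beta>M in simp)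
    also have "\<dots> = (\<Sum>h\<in>int ` {..<m}. (cmod (B h))\<^sup>2)" by (simp add: sum.reindex)
    also have "\<dots> \<le> (\<Sum>h\<in>{- int M..int N}. (cmod (B h))\<^sup>2)"
    proof (rule sum_mono2)
      show "int ` {..<m} \<subseteq> {- int M..int N}"
      proof clarify
        fix h assume "h < m"
        then have "real h \<le> real N" using m_lt[of h] \<beta>M M(2) by linarith
        then show "int h \<in> {- int M..int N}" by simp
      qed
    qed auto
    finally show ?thesis .
  qed
  have "((\<beta> * real M / 4) * (\<beta> * real M / 2)\<^sup>2)\<^sup>2 \<le> (\<Sum>h\<in>{- int M..int N}. (cmod (B h))\<^sup>2)\<^sup>2"
    using lower \<beta>M by (intro power_mono) auto
  then have "((\<beta> * real M / 4) * (\<beta> * real M / 2)\<^sup>2)\<^sup>2 \<le> real M ^ 3 * S" using upper by linarith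
  moreover have "((\<beta> * real M / 4) * (\<beta> * real M / 2)\<^sup>2)\<^sup>2 = real M ^ 3 * (\<beta> ^ 6 * real M ^ 3 / 256)"
    by (simp add: power_mult_distrib power_divide eval_nat_numeral)
  ultimately have "real M ^ 3 * (\<beta> ^ 6 * real M ^ 3 / 256) \<le> real M ^ 3 * S" by simp
  moreover have "0 < real M ^ 3" using M(1) by simp
  ultimately show ?thesis unfolding S_def by (simp only: mult_le_cancel_left_pos)
qed

section \<open>Lower bound for the U^2 average\<close>

lemma gowers_two_lower_bound:
  assumes q: "q \<ge> 2"
  obtains c K :: real where "c > 0" "K > 0"
    "\<And>f N T. \<lbrakk>q_multiplicative q f; q ^ T \<le> N; N < q ^ (T + 1)\<rbrakk> \<Longrightarrow>
       c * exp (- K * (\<Sum>i<T. (total_defect q f i)\<^sup>2)) \<le> Re (gowers_avg 2 N f)"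
proof -
  define L where "L = ln (2 * real q)"
  define C where "C = 64 * (real q)\<^sup>2 * L"
  have C0: "C > 0" unfolding C_def L_def using q by (intro mult_pos_pos ln_gt_zero) auto
  define K where "K = C + 4 * C\<^sup>2"
  have K0: "K > 0" unfolding K_def using C0 by (intro add_pos_pos) auto
  show ?thesis
  \<comment> \<open>The correlation is at least \<beta> = exp (- K \<Sigma> - 16 C), and its sixth
    power enters. The cube 7^3 comes from counting cubes, 2 N + 5 <= 7 N, and q^3 from comparing N
    with the window length q^T.\<close>
  proof (rule that[of "exp (- 96 * C) / (256 * (7 * real q) ^ 3)" "6 * K"])
    show "exp (- 96 * C) / (256 * (7 * real q) ^ 3) > 0" using q by simp
    show "6 * K > 0" using K0 by simp
    fix f N T
    assume qm: "q_multiplicative q f" and N: "q ^ T \<le> N" "N < q ^ (T + 1)"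
    define \<Sigma> where "\<Sigma> = (\<Sum>i<T. (total_defect q f i)\<^sup>2)"
    define M where "M = q ^ T"
    have M1: "1 \<le> M" using q by (simp add: M_def)
    have \<Sigma>0: "0 \<le> \<Sigma>" unfolding \<Sigma>_def by (intro sum_nonneg) auto
    obtain w where w: "cmod w = 1" and corr: "real (q ^ T) * exp (- K * \<Sigma> -
        4 * C * (4 - (cmod (w - f 1))\<^sup>2)) \<le> cmod (\<Sum>n<q ^ T. f n * cnj w ^ n)"
      using exists_linear_correlation[OF q L_def C_def qm, of T] unfolding \<Sigma>_def K_def by blast
    define \<beta> where "\<beta> = exp (- K * \<Sigma> - 16 * C)"
    have "4 * C * (4 - (cmod (w - f 1))\<^sup>2) \<le> 4 * C * 4" using C0 by (intro mult_left_mono) auto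
    then have "\<beta> \<le> exp (- K * \<Sigma> - 4 * C * (4 - (cmod (w - f 1))\<^sup>2))" unfolding \<beta>_def by simp
    then have "real M * \<beta> \<le> real M * exp (- K * \<Sigma> - 4 * C * (4 - (cmod (w - f 1))\<^sup>2))"
      by (intro mult_left_mono) auto
    then have \<beta>1: "\<beta> * real M \<le> cmod (\<Sum>n<M. f n * cnj w ^ n)"
      using corr unfolding M_def by (simp add: mult.commute)
    have "0 \<le> K * \<Sigma>" using K0 \<Sigma>0 by simp
    then have \<beta>2: "0 \<le> \<beta>" "\<beta> \<le> 1" unfolding \<beta>_def using C0 by auto
    define U where "U = (\<Sum>a\<in>{- int N..int N}. (cmod (autocorr N (interval_ext N f) a))\<^sup>2)"
    have U: "\<beta> ^ 6 * real M ^ 3 / 256 \<le> U" unfolding U_def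
      using q_multiplicative_unit[OF qm] w M1 N(1)[folded M_def] \<beta>1 \<beta>2
      by (rule gowers_two_ge_correlation)
    have "gowers_avg 2 N f = of_real (U / real (card (Pi_set 2 N)))"
      unfolding gowers_avg_def sum_Pi_set_two_eq_norms U_def by simp
    then have avg: "Re (gowers_avg 2 N f) = U / real (card (Pi_set 2 N))" by (metis Re_complex_of_real)
    have NM: "real N \<le> real q * real M"
    proof -
      have "N \<le> q * M" using N(2) by (simp add: M_def)
      then show ?thesis by (simp only: of_nat_mult[symmetric] of_nat_le_iff)
    qed
    have N1: "N \<ge> 1" using N(1) M1 M_def by linarith
    have "card (Pi_set 2 N) \<le> (2 * (N + 2) + 1) ^ (2 + 1)"
      unfolding Pi_set_eq_shifted_cubes by (rule card_shifted_cubes_le) auto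
    also have "2 + 1 = (3::nat)" by simp
    also have "(2 * (N + 2) + 1) ^ 3 \<le> (7 * N) ^ 3" using N1 by (intro power_mono) auto
    finally have "real (card (Pi_set 2 N)) \<le> real ((7 * N) ^ 3)" by (simp only: of_nat_le_iff)
    also have "\<dots> = (7 * real N) ^ 3" by simp
    also have "\<dots> \<le> (7 * (real q * real M)) ^ 3" using NM by (intro power_mono) auto
    finally have cardle: "real (card (Pi_set 2 N)) \<le> (7 * (real q * real M)) ^ 3" .
    have cardpos: "0 < real (card (Pi_set 2 N))"
    proof -
      have "0 < (real N / real (2 + 1)) ^ (2 + 1)" using N1 by simp
      then show ?thesis using card_Pi_set_ge[OF N1, of 2] by linarith
    qed
    have "\<beta> ^ 6 = exp (real 6 * (- K * \<Sigma> - 16 * C))" unfolding \<beta>_def by (rule exp_of_nat_mult[symmetric])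
    also have "\<dots> = exp (- 96 * C) * exp (- (6 * K) * \<Sigma>)" by (simp add: exp_add[symmetric] algebra_simps)
    finally have \<beta>6: "\<beta> ^ 6 = exp (- 96 * C) * exp (- (6 * K) * \<Sigma>)" .
    have "exp (- 96 * C) / (256 * (7 * real q) ^ 3) * exp (- (6 * K) * \<Sigma>) =
        (\<beta> ^ 6 * real M ^ 3 / 256) / (7 * (real q * real M)) ^ 3"
      unfolding \<beta>6 using M1 q by (simp add: power_mult_distrib field_simps)
    also have "\<dots> \<le> U / real (card (Pi_set 2 N))"
    proof (rule frac_le)
      have "0 \<le> \<beta> ^ 6 * real M ^ 3 / 256" using \<beta>2 by simp
      then show "0 \<le> U" using U by linarith
    qed (use U cardle cardpos in auto)
    finally show "exp (- 96 * C) / (256 * (7 * real q) ^ 3) *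
        exp (- (6 * K) * (\<Sum>i<T. (total_defect q f i)\<^sup>2)) \<le> Re (gowers_avg 2 N f)"
      unfolding avg \<Sigma>_def .
  qed
qed

section \<open>Comparison of the two exponents\<close>

lemma total_defect_le:
  assumes "q_multiplicative q f"
  shows "total_defect q f i \<le> 2 * real q"
proof -
  have "digit_defect q f i j \<le> 2" for j
    unfolding digit_defect_def using norm_triangle_ineq4[of "f (q ^ i * (j + 1))" "f (q ^ i * j) * f (q ^ i)"]
    by (simp add: norm_mult q_multiplicative_unit[OF assms])
  then have "total_defect q f i \<le> (\<Sum>j<q. 2)" unfolding total_defect_def by (intro sum_mono)
  then show ?thesis by simp
qed

text \<open>The upper bound reads the positions b, ..., T + b - 1 and the lower bound reads 0, ...,
  T - 1. At most b initial terms are missing from the former, and each is bounded by (2 q)^2,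
  independently of f and T.\<close>

lemma sum_total_defect_shift_le:
  assumes "q_multiplicative q f"
  shows "(\<Sum>i<T. (total_defect q f i)\<^sup>2) \<le>
    real b * (2 * real q)\<^sup>2 + (\<Sum>i<T. (total_defect q f (i + b))\<^sup>2)"
proof -
  have split: "(\<Sum>i<b + T. (total_defect q f i)\<^sup>2) =
      (\<Sum>i<b. (total_defect q f i)\<^sup>2) + (\<Sum>i<T. (total_defect q f (i + b))\<^sup>2)"
    by (induction T) (simp_all add: add.commute)
  have "(\<Sum>i<T. (total_defect q f i)\<^sup>2) \<le> (\<Sum>i<b + T. (total_defect q f i)\<^sup>2)"
    by (intro sum_mono2) auto
  moreover have "(\<Sum>i<b. (total_defect q f i)\<^sup>2) \<le> (\<Sum>i<b. (2 * real q)\<^sup>2)"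
    by (intro sum_mono power_mono total_defect_le[OF assms] total_defect_nonneg)
  ultimately show ?thesis unfolding split by simp
qed

theorem theoremB:
  fixes q :: nat
  assumes "q \<ge> 2"
  shows "\<forall>s::nat. s \<ge> 2 \<longrightarrow>
    (\<exists>\<kappa> C::real. \<kappa> > 0 \<and> C > 0 \<and>
      (\<forall>f N. q_multiplicative q f \<longrightarrow> N \<ge> 1 \<longrightarrow>
         gowers_norm s N f \<le> C * gowers_norm 2 N f powr \<kappa>))"
proof (intro allI impI)
  fix s :: nat assume s: "s \<ge> 2"
  obtain b and c C :: real where c: "c > 0" and C: "C > 0" and
    upper: "\<And>f N T. \<lbrakk>q_multiplicative q f; q ^ T \<le> N; N < q ^ (T + 1)\<rbrakk> \<Longrightarrow>
       cmod (gowers_avg s N f) \<le> C * exp (- c * (\<Sum>i<T. (total_defect q f (i + b))\<^sup>2))"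
    using gowers_avg_upper_bound[OF assms s] by metis
  obtain c' K :: real where c': "c' > 0" and K: "K > 0" and
    lower: "\<And>f N T. \<lbrakk>q_multiplicative q f; q ^ T \<le> N; N < q ^ (T + 1)\<rbrakk> \<Longrightarrow>
       c' * exp (- K * (\<Sum>i<T. (total_defect q f i)\<^sup>2)) \<le> Re (gowers_avg 2 N f)"
    using gowers_two_lower_bound[OF assms] by metis
  define a where "a = c' * exp (- K * (real b * (2 * real q)\<^sup>2))"
  have a: "a > 0" using c' by (simp add: a_def)
  define p :: real where "p = 1 / 2 ^ s"
  have p: "p > 0" by (simp add: p_def)
  \<comment> \<open>The U^2 norm is a fourth root, so its power \<kappa> decays at the rate K
    \<kappa> / 4. This choice makes it equal to c p, the rate for the U^s norm.\<close>
  define \<kappa> where "\<kappa> = 4 * c * p / K"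
  have \<kappa>: "\<kappa> > 0" using c p K by (simp add: \<kappa>_def)
  show "\<exists>\<kappa> C::real. \<kappa> > 0 \<and> C > 0 \<and> (\<forall>f N. q_multiplicative q f \<longrightarrow> N \<ge> 1 \<longrightarrow>
         gowers_norm s N f \<le> C * gowers_norm 2 N f powr \<kappa>)"
  proof (rule exI[of _ \<kappa>], rule exI[of _ "C powr p / a powr (\<kappa> / 4)"], intro conjI allI impI)
    show "\<kappa> > 0" by (rule \<kappa>)
    show "C powr p / a powr (\<kappa> / 4) > 0" using C a by simp
    fix f N assume qm: "q_multiplicative q f" and N1: "N \<ge> (1::nat)"
    obtain T where T: "q ^ T \<le> N" "N < q ^ (T + 1)" using ex_power_ivl1[OF assms N1] by blast
    define \<Sigma> where "\<Sigma> = (\<Sum>i<T. (total_defect q f (i + b))\<^sup>2)"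
    have "Re (gowers_avg s N f) \<le> C * exp (- c * \<Sigma>)"
      using upper[OF qm T] complex_Re_le_cmod[of "gowers_avg s N f"] unfolding \<Sigma>_def by linarith
    \<comment> \<open>\<open>root\<close> is increasing on all reals and takes negative values at
      negative arguments, so the estimate passes through it whatever the sign of the real
      part.\<close>
    then have "gowers_norm s N f \<le> root (2 ^ s) (C * exp (- c * \<Sigma>))"
      unfolding gowers_norm_def by simp
    also have "\<dots> = (C * exp (- c * \<Sigma>)) powr p"
      using C by (simp add: root_powr_inverse p_def)
    also have "\<dots> = C powr p * exp (- c * \<Sigma> * p)"
      using C by (simp add: powr_mult powr_def[of "exp _"] mult.commute)
    finally have up: "gowers_norm s N f \<le> C powr p * exp (- c * \<Sigma> * p)" .
    have "a * exp (- K * \<Sigma>) = c' * exp (- K * (real b * (2 * real q)\<^sup>2 + \<Sigma>))"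
      by (simp add: a_def exp_add[symmetric] algebra_simps)
    also have "\<dots> \<le> c' * exp (- K * (\<Sum>i<T. (total_defect q f i)\<^sup>2))"
      using sum_total_defect_shift_le[OF qm, of T b] K c' unfolding \<Sigma>_def by simp
    also have "\<dots> \<le> Re (gowers_avg 2 N f)" by (rule lower[OF qm T])
    finally have low: "a * exp (- K * \<Sigma>) \<le> Re (gowers_avg 2 N f)" .
    have pos: "0 < a * exp (- K * \<Sigma>)" using a by simp
    have "a powr (\<kappa> / 4) * exp (- c * \<Sigma> * p) = (a * exp (- K * \<Sigma>)) powr (\<kappa> / 4)"
      using a K by (simp add: powr_mult powr_def[of "exp _"] \<kappa>_def)
    also have "\<dots> \<le> Re (gowers_avg 2 N f) powr (\<kappa> / 4)"
      using low pos \<kappa> by (intro powr_mono2) auto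
    also have "\<dots> = gowers_norm 2 N f powr \<kappa>"
      using low pos by (simp add: gowers_norm_def root_powr_inverse powr_powr)
    finally have "exp (- c * \<Sigma> * p) \<le> gowers_norm 2 N f powr \<kappa> / a powr (\<kappa> / 4)"
      using a by (simp add: field_simps)
    then have "C powr p * exp (- c * \<Sigma> * p) \<le> C powr p * (gowers_norm 2 N f powr \<kappa> / a powr (\<kappa> / 4))"
      by (intro mult_left_mono) auto
    then show "gowers_norm s N f \<le> C powr p / a powr (\<kappa> / 4) * gowers_norm 2 N f powr \<kappa>"
      using up by simp
  qed
qed

end
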